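(* Let $\mathbb X$ be a virtual equipment and let $j\colon A\to E$ be a tight-cell in $\mathbb X$. There is a functor $E(j,-)\colon\mathbf{RMnd}(j)\to\mathbf{LMnd}(A)$ from the category of $j$-relative monads to the category of loose-monads on $A$ (sending a $j$-relative monad with carrier $t$ to a loose-monad with underlying loose-cell $E(j,t)\colon A\nrightarrow A$). This functor is fully faithful if $j$ is dense, in which case the square of categories $$\begin{array}{ccc}\mathbf{RMnd}(j)&\xrightarrow{\;E(j,-)\;}&\mathbf{LMnd}(A)\\ {\scriptstyle U_j}\downarrow&&\downarrow{\scriptstyle U_A}\\ \mathbb X[A,E]&\xrightarrow{\;E(j,-)\;}&\mathbb X[[A,A]]\end{array}$$ is a pullback of categories.
   Context: Virtual equipments. A virtual double category has objects; a category of tight-cells $f\colon A\to B$ (the composite of $f\colon A\to B$ and $g\colon B\to C$ is $gf$); loose-cells $p\colon A\nrightarrow B$; and 2-cells, each having as frame a chain of loose-cells $p_1\colon A_1\nrightarrow A_0,\dots,p_n\colon A_n\nrightarrow A_{n-1}$ ($n\ge 0$; chains are always listed in this order), a loose-cell $q\colon B_n\nrightarrow B_0$, and tight-cells $f_0\colon A_0\to B_0$ (left) and $f_n\colon A_n\to B_n$ (right); 2-cells have identities and associative unital multicategory-style composition. $\phi\colon p_1,\dots,p_n\Rightarrow q$ denotes a 2-cell whose tight-cells are identities; $(\phi_1,\dots,\phi_n)$ denotes juxtaposition. A 2-cell $q_1,\dots,q_m\Rightarrow q$ is opcartesian if every 2-cell (with any tight-cells) with domain $p_1,\dots,p_l,q_1,\dots,q_m,r_1,\dots,r_n$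 factors uniquely through it; then $q$ is the loose-composite $q_1\odot\cdots\odot q_m$ (the loose-identity $A(1,1)\colon A\nrightarrow A$ if $m=0$). A unary 2-cell from $p$ to $q$ with left $f$ and right $g$ is cartesian if every 2-cell into $q$ with left $ff'$ and right $gg'$ factors uniquely through it via a 2-cell with left $f'$ and right $g'$; then $p$ is the restriction $q(f,g)$. A virtual equipment has all loose-identities and restrictions. Write $E(f,g):=E(1,1)(f,g)$; for $f\colon D\to E$, $g\colon A\to E$ it is a loose-cell $A\nrightarrow D$. The canonical isomorphisms $q(f,g)\cong C(f,1)\odot q\odot B(1,g)$ are used implicitly. A 2-cell $f\Rightarrow g$ between tight-cells $A\to B$ is equivalently a 2-cell $B(1,f)\Rightarrow B(1,g)$, or $B(g,1)\Rightarrow B(f,1)$, or $()\Rightarrow B(f,g)$; $\mathbb X[A,B]$ is the category of tight-cells $A\to B$ and such 2-cells, and $\mathbb X[[A,B]]$ is the category of loose-cells $A\nrightarrow B$ and 2-cells $p\Rightarrow q$. Restriction is functorial in 2-cells (contravariantly in the first argument, covariantly in the second). For $f\colon A\to B$, $\frown_f\colon ()\Rightarrow B(f,f)$ (corresponding to $1_f$) and $\smile_f\colon B(1,f),B(f,1)\Rightarrow B(1,1)$ are the canonical 2-cells (unit and counit of the adjunction $B(1,f)\dashv B(f,1)$). $\phi(f,g)$ denotes the 2-cell obtained from $\phi$ by restricting along $f$ on the left and $g$ on the right; e.g. $\smile_t(x,y)\colon E(x,t),E(t,y)\Rightarrow E(x,y)$ is composition. Density. A tight-cell $j\colon A\to E$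 is dense if $1_j$ exhibits $1_E$ as the pointwise left extension of $j$ along $j$; explicitly, if for every chain $r_1,\dots,r_n$ ($n\ge0$) from $E$ to $E$, the assignment sending $\phi\colon r_1,\dots,r_n\Rightarrow E(1,1)$ to $(1_{E(j,1)},\phi)\colon E(j,1),r_1,\dots,r_n\Rightarrow E(j,1)$ is a bijection, and likewise for chains $r_1,\dots,r_n$ from any object $X$ to $E$ and targets $E(1,x)$, $E(j,x)$ with $x\colon X\to E$ (this follows by restriction). Relative monads. A $j$-relative monad $(t,\dagger,\eta)$ comprises a tight-cell $t\colon A\to E$, a 2-cell $\dagger\colon E(j,t)\Rightarrow E(t,t)$ and a 2-cell $\eta\colon j\Rightarrow t$ such that: (i) $E(\eta,t)\circ\dagger=1_{E(j,t)}$; (ii) $\dagger\circ E(j,\eta)\circ\frown_j=\frown_t$ as 2-cells $()\Rightarrow E(t,t)$; (iii) the following two 2-cells $E(j,t),E(j,t)\Rightarrow E(t,t)$ are equal: $(\dagger,\dagger)$ followed by $\smile_t(t,t)$; and $(1,\dagger)$ followed by $\smile_t(j,t)\colon E(j,t),E(t,t)\Rightarrow E(j,t)$ followed by $\dagger$. A morphism $(t,\dagger,\eta)\to(t',\dagger',\eta')$ is a 2-cell $\tau\colon t\Rightarrow t'$ with $\tau\circ\eta=\eta'$ and $E(t,\tau)\circ\dagger=E(\tau,t')\circ\dagger'\circ E(j,\tau)$. These form $\mathbf{RMnd}(j)$; $U_j\colon\mathbf{RMnd}(j)\to\mathbb X[A,E]$ sends $(t,\dagger,\eta)$ to $t$.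 Loose-monads. A loose-monad on $A$ comprises a loose-cell $s\colon A\nrightarrow A$ and 2-cells $\mu\colon s,s\Rightarrow s$ and $u\colon()\Rightarrow s$ with $\mu\circ(\mu,1)=\mu\circ(1,\mu)$ and $\mu\circ(u,1)=1_s=\mu\circ(1,u)$. A morphism is a 2-cell $\tau\colon s\Rightarrow s'$ with $\tau\circ u=u'$ and $\tau\circ\mu=\mu'\circ(\tau,\tau)$. These form $\mathbf{LMnd}(A)$; $U_A\colon\mathbf{LMnd}(A)\to\mathbb X[[A,A]]$ is the forgetful functor. The loose-monad $E(j,T)$ associated to $T=(t,\dagger,\eta)$ is $E(j,t)$ with unit $E(j,\eta)\circ\frown_j$ and multiplication $(1,\dagger)$ followed by $\smile_t(j,t)$; a morphism $\tau$ is sent to $E(j,\tau)$. *)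

theory Defs
  imports Main
begin

section \<open>Categories and functors\<close>

text \<open>
  Categories are given by hom-sets indexed by their objects; hom-sets of different pairs of objects
  need not be disjoint, so composition and the action of a functor on morphisms take the objects as
  arguments. \<open>Cmp C x y z g f\<close> is the composite \<open>g \<circ> f\<close> of \<open>f : x \<rightarrow> y\<close> and \<open>g : y \<rightarrow> z\<close>.
\<close>

record ('x, 'm) cat =
  Ob :: "'x set"
  Hom :: "'x \<Rightarrow> 'x \<Rightarrow> 'm set"
  Idm :: "'x \<Rightarrow> 'm"
  Cmp :: "'x \<Rightarrow> 'x \<Rightarrow> 'x \<Rightarrow> 'm \<Rightarrow> 'm \<Rightarrow> 'm"

definition is_category :: "('x, 'm) cat \<Rightarrow> bool" where
  "is_category C \<longleftrightarrow>
     (\<forall>x\<in>Ob C. Idm C x \<in> Hom C x x) \<and>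
     (\<forall>x\<in>Ob C. \<forall>y\<in>Ob C. \<forall>z\<in>Ob C. \<forall>f\<in>Hom C x y. \<forall>g\<in>Hom C y z. Cmp C x y z g f \<in> Hom C x z) \<and>
     (\<forall>x\<in>Ob C. \<forall>y\<in>Ob C. \<forall>f\<in>Hom C x y. Cmp C x x y f (Idm C x) = f \<and> Cmp C x y y (Idm C y) f = f) \<and>
     (\<forall>w\<in>Ob C. \<forall>x\<in>Ob C. \<forall>y\<in>Ob C. \<forall>z\<in>Ob C. \<forall>f\<in>Hom C w x. \<forall>g\<in>Hom C x y. \<forall>h\<in>Hom C y z.
        Cmp C w x z (Cmp C x y z h g) f = Cmp C w y z h (Cmp C w x y g f))"

record ('x, 'm, 'y, 'n) funct =
  fob :: "'x \<Rightarrow> 'y"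
  fmor :: "'x \<Rightarrow> 'x \<Rightarrow> 'm \<Rightarrow> 'n"

definition is_functor :: "('x, 'm) cat \<Rightarrow> ('y, 'n) cat \<Rightarrow> ('x, 'm, 'y, 'n) funct \<Rightarrow> bool" where
  "is_functor C D F \<longleftrightarrow> is_category C \<and> is_category D \<and>
     (\<forall>x\<in>Ob C. fob F x \<in> Ob D) \<and>
     (\<forall>x\<in>Ob C. \<forall>y\<in>Ob C. \<forall>f\<in>Hom C x y. fmor F x y f \<in> Hom D (fob F x) (fob F y)) \<and>
     (\<forall>x\<in>Ob C. fmor F x x (Idm C x) = Idm D (fob F x)) \<and>
     (\<forall>x\<in>Ob C. \<forall>y\<in>Ob C. \<forall>z\<in>Ob C. \<forall>f\<in>Hom C x y. \<forall>g\<in>Hom C y z.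
        fmor F x z (Cmp C x y z g f)
          = Cmp D (fob F x) (fob F y) (fob F z) (fmor F y z g) (fmor F x y f))"

definition funct_comp ::
    "('y, 'n, 'z, 'k) funct \<Rightarrow> ('x, 'm, 'y, 'n) funct \<Rightarrow> ('x, 'm, 'z, 'k) funct" where
  "funct_comp G F = \<lparr> fob = (\<lambda>x. fob G (fob F x)),
                      fmor = (\<lambda>x y f. fmor G (fob F x) (fob F y) (fmor F x y f)) \<rparr>"

text \<open>Equality of functors with domain \<open>C\<close>: values outside the carriers of \<open>C\<close> are irrelevant.\<close>

definition funct_eq ::
    "('x, 'm) cat \<Rightarrow> ('x, 'm, 'y, 'n) funct \<Rightarrow> ('x, 'm, 'y, 'n) funct \<Rightarrow> bool" where
  "funct_eq C F G \<longleftrightarrow>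
     (\<forall>x\<in>Ob C. fob F x = fob G x) \<and>
     (\<forall>x\<in>Ob C. \<forall>y\<in>Ob C. \<forall>f\<in>Hom C x y. fmor F x y f = fmor G x y f)"

definition fully_faithful :: "('x, 'm) cat \<Rightarrow> ('y, 'n) cat \<Rightarrow> ('x, 'm, 'y, 'n) funct \<Rightarrow> bool" where
  "fully_faithful C D F \<longleftrightarrow>
     (\<forall>x\<in>Ob C. \<forall>y\<in>Ob C. bij_betw (fmor F x y) (Hom C x y) (Hom D (fob F x) (fob F y)))"

text \<open>
  The square with top \<open>F : P \<rightarrow> B\<close>, left \<open>U : P \<rightarrow> C\<close>, right \<open>V : B \<rightarrow> D\<close> and bottom \<open>G : C \<rightarrow> D\<close>
  commutes strictly and has the universal property of a pullback. A constant cannot quantify over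
  types, so the types of objects and morphisms of the test categories \<open>Z\<close> are parameters; leaving
  them as free type variables in a theorem gives the universal property for all categories \<open>Z\<close>.
\<close>

definition is_pullback ::
    "'zx itself \<Rightarrow> 'zm itself \<Rightarrow> ('a, 'b) cat \<Rightarrow> ('c, 'd) cat \<Rightarrow> ('e, 'f) cat \<Rightarrow> ('g, 'h) cat \<Rightarrow>
     ('a, 'b, 'c, 'd) funct \<Rightarrow> ('a, 'b, 'e, 'f) funct \<Rightarrow>
     ('c, 'd, 'g, 'h) funct \<Rightarrow> ('e, 'f, 'g, 'h) funct \<Rightarrow> bool" where
  "is_pullback _ _ P B C D F U V G \<longleftrightarrow>
     is_functor P B F \<and> is_functor P C U \<and> is_functor B D V \<and> is_functor C D G \<and>
     funct_eq P (funct_comp V F) (funct_comp G U) \<and>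
     (\<forall>(Z :: ('zx, 'zm) cat) H K.
        is_functor Z B H \<and> is_functor Z C K \<and> funct_eq Z (funct_comp V H) (funct_comp G K) \<longrightarrow>
        (\<exists>M. is_functor Z P M \<and> funct_eq Z (funct_comp F M) H \<and> funct_eq Z (funct_comp U M) K \<and>
             (\<forall>M'. is_functor Z P M' \<and> funct_eq Z (funct_comp F M') H \<and>
                   funct_eq Z (funct_comp U M') K \<longrightarrow> funct_eq Z M M')))"


section \<open>Virtual double categories\<close>

text \<open>
  \<open>tcomp X g f\<close> is the composite \<open>gf\<close>. A loose-cell \<open>p\<close> goes from \<open>lsrc X p\<close> to \<open>ltgt X p\<close>.
  A 2-cell \<open>c\<close> has the frame \<open>cdom X c\<close> (a list of loose-cells), \<open>ccod X c\<close> (a loose-cell),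
  \<open>cleft X c\<close> and \<open>cright X c\<close> (tight-cells).
  \<open>ccomp X c f [c\<^sub>1, \<dots>, c\<^sub>m]\<close> is the multicategorical composite of the row \<open>c\<^sub>1, \<dots>, c\<^sub>m\<close> followed
  by \<open>c\<close>. The tight-cell \<open>f\<close> is the left boundary of the row: it is determined by \<open>c\<^sub>1\<close> if \<open>m > 0\<close>,
  but is a necessary datum if \<open>m = 0\<close>, when the composite is \<open>c\<close> precomposed with \<open>f\<close>.
\<close>

record ('o, 't, 'l, 'c) vdc =
  objs :: "'o set"
  tights :: "'t set"
  tdom :: "'t \<Rightarrow> 'o"
  tcod :: "'t \<Rightarrow> 'o"
  tid :: "'o \<Rightarrow> 't"
  tcomp :: "'t \<Rightarrow> 't \<Rightarrow> 't"
  looses :: "'l set"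
  lsrc :: "'l \<Rightarrow> 'o"
  ltgt :: "'l \<Rightarrow> 'o"
  cells :: "'c set"
  cdom :: "'c \<Rightarrow> 'l list"
  ccod :: "'c \<Rightarrow> 'l"
  cleft :: "'c \<Rightarrow> 't"
  cright :: "'c \<Rightarrow> 't"
  cid :: "'l \<Rightarrow> 'c"
  ccomp :: "'c \<Rightarrow> 't \<Rightarrow> 'c list \<Rightarrow> 'c"

text \<open>\<open>chain X A\<^sub>0 [p\<^sub>1, \<dots>, p\<^sub>n] A\<^sub>n\<close> where \<open>p\<^sub>i\<close> goes from \<open>A\<^sub>i\<close> to \<open>A\<^sub>i\<^sub>-\<^sub>1\<close>.\<close>

primrec chain :: "('o, 't, 'l, 'c, 'm) vdc_scheme \<Rightarrow> 'o \<Rightarrow> 'l list \<Rightarrow> 'o \<Rightarrow> bool" where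
  "chain X A [] B \<longleftrightarrow> A \<in> objs X \<and> A = B"
| "chain X A (p # ps) B \<longleftrightarrow> p \<in> looses X \<and> ltgt X p = A \<and> chain X (lsrc X p) ps B"

text \<open>
  \<open>row X f cs\<close>: the 2-cells \<open>cs\<close> can be juxtaposed, with leftmost boundary \<open>f\<close>;
  \<open>row_right X f cs\<close> is then the rightmost boundary.
\<close>

primrec row :: "('o, 't, 'l, 'c, 'm) vdc_scheme \<Rightarrow> 't \<Rightarrow> 'c list \<Rightarrow> bool" where
  "row X f [] \<longleftrightarrow> f \<in> tights X"
| "row X f (c # cs) \<longleftrightarrow> c \<in> cells X \<and> cleft X c = f \<and> row X (cright X c) cs"

primrec row_right :: "('o, 't, 'l, 'c, 'm) vdc_scheme \<Rightarrow> 't \<Rightarrow> 'c list \<Rightarrow> 't" where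
  "row_right X f [] = f"
| "row_right X f (c # cs) = row_right X (cright X c) cs"

definition composable :: "('o, 't, 'l, 'c, 'm) vdc_scheme \<Rightarrow> 'c \<Rightarrow> 't \<Rightarrow> 'c list \<Rightarrow> bool" where
  "composable X c f cs \<longleftrightarrow>
     c \<in> cells X \<and> row X f cs \<and> map (ccod X) cs = cdom X c \<and> tcod X f = tdom X (cleft X c)"

text \<open>
  For rows \<open>cs\<close> and \<open>ds\<close> with \<open>ds\<close> placed on top of \<open>cs\<close>, and \<open>h\<close> the left boundary of \<open>ds\<close>:
  compose each member of \<open>cs\<close> with the corresponding segment of \<open>ds\<close>.
\<close>

primrec distribute ::
    "('o, 't, 'l, 'c, 'm) vdc_scheme \<Rightarrow> 't \<Rightarrow> 'c list \<Rightarrow> 'c list \<Rightarrow> 'c list" where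
  "distribute X h [] ds = []"
| "distribute X h (c # cs) ds =
     (let n = length (cdom X c)
      in ccomp X c h (take n ds) # distribute X (row_right X h (take n ds)) cs (drop n ds))"

locale virtual_double_category =
  fixes X :: "('o, 't, 'l, 'c, 'm) vdc_scheme"
  assumes tdom_in: "f \<in> tights X \<Longrightarrow> tdom X f \<in> objs X"
    and tcod_in: "f \<in> tights X \<Longrightarrow> tcod X f \<in> objs X"
    and tid_in: "A \<in> objs X \<Longrightarrow> tid X A \<in> tights X \<and> tdom X (tid X A) = A \<and> tcod X (tid X A) = A"
    and tcomp_in: "\<lbrakk>f \<in> tights X; g \<in> tights X; tcod X f = tdom X g\<rbrakk> \<Longrightarrow>
      tcomp X g f \<in> tights X \<and> tdom X (tcomp X g f) = tdom X f \<and> tcod X (tcomp X g f) = tcod X g"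
    and tid_right: "f \<in> tights X \<Longrightarrow> tcomp X f (tid X (tdom X f)) = f"
    and tid_left: "f \<in> tights X \<Longrightarrow> tcomp X (tid X (tcod X f)) f = f"
    and tcomp_assoc: "\<lbrakk>f \<in> tights X; g \<in> tights X; h \<in> tights X;
      tcod X f = tdom X g; tcod X g = tdom X h\<rbrakk> \<Longrightarrow>
      tcomp X (tcomp X h g) f = tcomp X h (tcomp X g f)"
    and lsrc_in: "p \<in> looses X \<Longrightarrow> lsrc X p \<in> objs X"
    and ltgt_in: "p \<in> looses X \<Longrightarrow> ltgt X p \<in> objs X"
    and cell_frame: "c \<in> cells X \<Longrightarrow>
      cleft X c \<in> tights X \<and> cright X c \<in> tights X \<and> ccod X c \<in> looses X \<and>
      chain X (tdom X (cleft X c)) (cdom X c) (tdom X (cright X c)) \<and>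
      ltgt X (ccod X c) = tcod X (cleft X c) \<and> lsrc X (ccod X c) = tcod X (cright X c)"
    and cid_in: "p \<in> looses X \<Longrightarrow>
      cid X p \<in> cells X \<and> cdom X (cid X p) = [p] \<and> ccod X (cid X p) = p \<and>
      cleft X (cid X p) = tid X (ltgt X p) \<and> cright X (cid X p) = tid X (lsrc X p)"
    and ccomp_in: "composable X c f cs \<Longrightarrow>
      ccomp X c f cs \<in> cells X \<and> cdom X (ccomp X c f cs) = concat (map (cdom X) cs) \<and>
      ccod X (ccomp X c f cs) = ccod X c \<and> cleft X (ccomp X c f cs) = tcomp X (cleft X c) f \<and>
      cright X (ccomp X c f cs) = tcomp X (cright X c) (row_right X f cs)"
    and cid_right: "c \<in> cells X \<Longrightarrow>
      ccomp X c (tid X (tdom X (cleft X c))) (map (cid X) (cdom X c)) = c"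
    and cid_left: "c \<in> cells X \<Longrightarrow> ccomp X (cid X (ccod X c)) (cleft X c) [c] = c"
    and ccomp_assoc: "\<lbrakk>composable X c f cs; composable X (ccomp X c f cs) h ds\<rbrakk> \<Longrightarrow>
      ccomp X (ccomp X c f cs) h ds = ccomp X c (tcomp X f h) (distribute X h cs ds)"

text \<open>\<open>glob X ps q\<close> is the set of 2-cells \<open>ps \<Rightarrow> q\<close> whose tight-cells are identities.\<close>

definition glob :: "('o, 't, 'l, 'c, 'm) vdc_scheme \<Rightarrow> 'l list \<Rightarrow> 'l \<Rightarrow> 'c set" where
  "glob X ps q = {c \<in> cells X. cdom X c = ps \<and> ccod X c = q \<and>
                    cleft X c = tid X (ltgt X q) \<and> cright X c = tid X (lsrc X q)}"

text \<open>\<open>gcomp X c cs\<close>: the juxtaposition \<open>cs\<close> followed by \<open>c\<close>, where \<open>cs\<close> has identity left boundary.\<close>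

definition gcomp :: "('o, 't, 'l, 'c, 'm) vdc_scheme \<Rightarrow> 'c \<Rightarrow> 'c list \<Rightarrow> 'c" where
  "gcomp X c cs = ccomp X c (tid X (tdom X (cleft X c))) cs"

text \<open>
  The condition \<open>chain \<dots> ps \<dots>\<close> places \<open>u\<close> between \<open>ps\<close> and \<open>rs\<close>; this is needed
  when \<open>u\<close> has empty domain.
\<close>

definition opcartesian :: "('o, 't, 'l, 'c, 'm) vdc_scheme \<Rightarrow> 'c \<Rightarrow> bool" where
  "opcartesian X u \<longleftrightarrow>
     u \<in> glob X (cdom X u) (ccod X u) \<and>
     (\<forall>d ps rs. d \<in> cells X \<and> cdom X d = ps @ cdom X u @ rs \<and>
                chain X (tdom X (cleft X d)) ps (ltgt X (ccod X u)) \<longrightarrow>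
        (\<exists>!e. e \<in> cells X \<and> cdom X e = ps @ [ccod X u] @ rs \<and> ccod X e = ccod X d \<and>
              cleft X e = cleft X d \<and> cright X e = cright X d \<and>
              gcomp X e (map (cid X) ps @ [u] @ map (cid X) rs) = d))"

definition cartesian :: "('o, 't, 'l, 'c, 'm) vdc_scheme \<Rightarrow> 'c \<Rightarrow> bool" where
  "cartesian X c \<longleftrightarrow>
     c \<in> cells X \<and> length (cdom X c) = 1 \<and>
     (\<forall>d f g. d \<in> cells X \<and> ccod X d = ccod X c \<and> f \<in> tights X \<and> g \<in> tights X \<and>
              tcod X f = tdom X (cleft X c) \<and> tcod X g = tdom X (cright X c) \<and>
              cleft X d = tcomp X (cleft X c) f \<and> cright X d = tcomp X (cright X c) g \<longrightarrow>
        (\<exists>!e. e \<in> cells X \<and> cdom X e = cdom X d \<and> ccod X e = hd (cdom X c) \<and>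
              cleft X e = f \<and> cright X e = g \<and> ccomp X c f [e] = d))"


section \<open>Virtual equipments\<close>

text \<open>
  A virtual equipment is taken with a choice of loose-identities and restrictions, in the form of the
  opcartesian 2-cells \<open>unit_cell X A : () \<Rightarrow> A(1,1)\<close> and the cartesian 2-cells
  \<open>restr_cell X q f g : q(f,g) \<Rightarrow> q\<close>. The choice is arbitrary; no strictness is required of it.
\<close>

record ('o, 't, 'l, 'c) vequip = "('o, 't, 'l, 'c) vdc" +
  unit_cell :: "'o \<Rightarrow> 'c"
  restr_cell :: "'l \<Rightarrow> 't \<Rightarrow> 't \<Rightarrow> 'c"

locale virtual_equipment = virtual_double_category X
  for X :: "('o, 't, 'l, 'c, 'm) vequip_scheme" +
  assumes unit_cell: "A \<in> objs X \<Longrightarrow>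
      opcartesian X (unit_cell X A) \<and> cdom X (unit_cell X A) = [] \<and>
      ltgt X (ccod X (unit_cell X A)) = A \<and> lsrc X (ccod X (unit_cell X A)) = A"
    and restr_cell: "\<lbrakk>q \<in> looses X; f \<in> tights X; g \<in> tights X; tcod X f = ltgt X q; tcod X g = lsrc X q\<rbrakk> \<Longrightarrow>
      cartesian X (restr_cell X q f g) \<and> ccod X (restr_cell X q f g) = q \<and>
      cleft X (restr_cell X q f g) = f \<and> cright X (restr_cell X q f g) = g"

text \<open>The loose-identity \<open>A(1,1)\<close>, the restriction \<open>q(f,g)\<close>, and \<open>E(f,g) = E(1,1)(f,g)\<close>.\<close>

definition lid :: "('o, 't, 'l, 'c, 'm) vequip_scheme \<Rightarrow> 'o \<Rightarrow> 'l" where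
  "lid X A = ccod X (unit_cell X A)"

definition restr :: "('o, 't, 'l, 'c, 'm) vequip_scheme \<Rightarrow> 'l \<Rightarrow> 't \<Rightarrow> 't \<Rightarrow> 'l" where
  "restr X q f g = hd (cdom X (restr_cell X q f g))"

definition hom :: "('o, 't, 'l, 'c, 'm) vequip_scheme \<Rightarrow> 't \<Rightarrow> 't \<Rightarrow> 'l" where
  "hom X f g = restr X (lid X (tcod X f)) f g"

definition hom_cell :: "('o, 't, 'l, 'c, 'm) vequip_scheme \<Rightarrow> 't \<Rightarrow> 't \<Rightarrow> 'c" where
  "hom_cell X f g = restr_cell X (lid X (tcod X f)) f g"

text \<open>
  The 2-cell with codomain \<open>E(f,g)\<close> and identity tight-cells corresponding to a 2-cell \<open>d\<close>
  with codomain \<open>E(1,1)\<close>, left \<open>f\<close> and right \<open>g\<close>.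
\<close>

definition hom_factor :: "('o, 't, 'l, 'c, 'm) vequip_scheme \<Rightarrow> 't \<Rightarrow> 't \<Rightarrow> 'c \<Rightarrow> 'c" where
  "hom_factor X f g d =
     (THE e. e \<in> glob X (cdom X d) (hom X f g) \<and> gcomp X (hom_cell X f g) [e] = d)"

text \<open>
  For \<open>p : B \<nrightarrow> A\<close>, the canonical 2-cell \<open>p, B(1,1) \<Rightarrow> p\<close> (exhibiting \<open>p\<close> as
  \<open>p \<odot> B(1,1)\<close>): the factorisation of the identity on \<open>p\<close> through the unit of \<open>B(1,1)\<close>.
\<close>

definition runitor :: "('o, 't, 'l, 'c, 'm) vequip_scheme \<Rightarrow> 'l \<Rightarrow> 'c" where
  "runitor X p =
     (THE e. e \<in> glob X [p, lid X (lsrc X p)] p \<and>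
             gcomp X e [cid X p, unit_cell X (lsrc X p)] = cid X p)"

text \<open>
  \<open>cap X f\<close> is \<open>\<frown>\<^sub>f : () \<Rightarrow> B(f,f)\<close>. \<open>smile X x t y\<close> is the composition 2-cell
  \<open>\<smile>\<^sub>t(x,y) : E(x,t), E(t,y) \<Rightarrow> E(x,y)\<close>, induced by
  \<open>E(x,t), E(t,y) \<Rightarrow> E(1,1), E(1,1) \<Rightarrow> E(1,1)\<close>, whose left is \<open>x\<close> and whose right is \<open>y\<close>.
\<close>

definition cap :: "('o, 't, 'l, 'c, 'm) vequip_scheme \<Rightarrow> 't \<Rightarrow> 'c" where
  "cap X f = hom_factor X f f (ccomp X (unit_cell X (tcod X f)) f [])"

definition smile :: "('o, 't, 'l, 'c, 'm) vequip_scheme \<Rightarrow> 't \<Rightarrow> 't \<Rightarrow> 't \<Rightarrow> 'c" where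
  "smile X x t y =
     hom_factor X x y
       (ccomp X (runitor X (lid X (tcod X t))) x [hom_cell X x t, hom_cell X t y])"

text \<open>
  A 2-cell \<open>f \<Rightarrow> g\<close> between tight-cells \<open>A \<rightarrow> B\<close> is represented as a 2-cell \<open>() \<Rightarrow> B(f,g)\<close>.
  For \<open>\<tau> : t \<Rightarrow> t'\<close>, \<open>hom_post X j t t' \<tau>\<close> is \<open>E(j,\<tau>) : E(j,t) \<Rightarrow> E(j,t')\<close> and
  \<open>hom_pre X t t' y \<tau>\<close> is \<open>E(\<tau>,y) : E(t',y) \<Rightarrow> E(t,y)\<close>.
\<close>

definition tight2 :: "('o, 't, 'l, 'c, 'm) vequip_scheme \<Rightarrow> 't \<Rightarrow> 't \<Rightarrow> 'c set" where
  "tight2 X f g = glob X [] (hom X f g)"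

definition tight2_comp ::
    "('o, 't, 'l, 'c, 'm) vequip_scheme \<Rightarrow> 't \<Rightarrow> 't \<Rightarrow> 't \<Rightarrow> 'c \<Rightarrow> 'c \<Rightarrow> 'c" where
  "tight2_comp X f g h \<tau> \<sigma> = gcomp X (smile X f g h) [\<sigma>, \<tau>]"

definition hom_post :: "('o, 't, 'l, 'c, 'm) vequip_scheme \<Rightarrow> 't \<Rightarrow> 't \<Rightarrow> 't \<Rightarrow> 'c \<Rightarrow> 'c" where
  "hom_post X j t t' \<tau> = gcomp X (smile X j t t') [cid X (hom X j t), \<tau>]"

definition hom_pre :: "('o, 't, 'l, 'c, 'm) vequip_scheme \<Rightarrow> 't \<Rightarrow> 't \<Rightarrow> 't \<Rightarrow> 'c \<Rightarrow> 'c" where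
  "hom_pre X t t' y \<tau> = gcomp X (smile X t t' y) [\<tau>, cid X (hom X t' y)]"

text \<open>\<open>\<X>[A,B]\<close> and \<open>\<X>[[A,B]]\<close>\<close>

definition tight_cat :: "('o, 't, 'l, 'c, 'm) vequip_scheme \<Rightarrow> 'o \<Rightarrow> 'o \<Rightarrow> ('t, 'c) cat" where
  "tight_cat X A B =
     \<lparr> Ob = {f \<in> tights X. tdom X f = A \<and> tcod X f = B},
       Hom = tight2 X,
       Idm = cap X,
       Cmp = tight2_comp X \<rparr>"

definition loose_cat :: "('o, 't, 'l, 'c, 'm) vequip_scheme \<Rightarrow> 'o \<Rightarrow> 'o \<Rightarrow> ('l, 'c) cat" where
  "loose_cat X A B =
     \<lparr> Ob = {p \<in> looses X. lsrc X p = A \<and> ltgt X p = B},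
       Hom = (\<lambda>p q. glob X [p] q),
       Idm = cid X,
       Cmp = (\<lambda>p q r d c. gcomp X d [c]) \<rparr>"

text \<open>
  Density of \<open>j : A \<rightarrow> E\<close>: for every chain \<open>rs\<close> from \<open>E\<close> to \<open>E\<close>, the assignment
  \<open>\<phi> \<mapsto> (1, \<phi>)\<close> from 2-cells \<open>rs \<Rightarrow> E(1,1)\<close> to 2-cells \<open>E(j,1), rs \<Rightarrow> E(j,1)\<close> is bijective,
  where \<open>(1, \<phi>)\<close> is followed by the canonical 2-cell \<open>E(j,1), E(1,1) \<Rightarrow> E(j,1)\<close>.
\<close>

definition dense :: "('o, 't, 'l, 'c, 'm) vequip_scheme \<Rightarrow> 't \<Rightarrow> bool" where
  "dense X j \<longleftrightarrow>
     (let E = tcod X j; E_j1 = hom X j (tid X E)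
      in \<forall>rs. chain X E rs E \<longrightarrow>
           bij_betw (\<lambda>\<phi>. gcomp X (runitor X E_j1) [cid X E_j1, \<phi>])
             (glob X rs (lid X E)) (glob X (E_j1 # rs) E_j1))"


section \<open>Relative monads and loose-monads\<close>

record ('t, 'c) relmonad =
  carrier :: 't
  ext :: 'c
  eta :: 'c

definition is_relmonad :: "('o, 't, 'l, 'c, 'm) vequip_scheme \<Rightarrow> 't \<Rightarrow> ('t, 'c) relmonad \<Rightarrow> bool" where
  "is_relmonad X j T \<longleftrightarrow>
     (let t = carrier T; e = ext T; h = eta T; j_t = hom X j t
      in t \<in> tights X \<and> tdom X t = tdom X j \<and> tcod X t = tcod X j \<and>
         e \<in> glob X [j_t] (hom X t t) \<and> h \<in> tight2 X j t \<and>
         gcomp X (hom_pre X j t t h) [e] = cid X j_t \<and>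
         gcomp X e [gcomp X (hom_post X j j t h) [cap X j]] = cap X t \<and>
         gcomp X (smile X t t t) [e, e] = gcomp X e [gcomp X (smile X j t t) [cid X j_t, e]])"

definition relmonad_hom ::
    "('o, 't, 'l, 'c, 'm) vequip_scheme \<Rightarrow> 't \<Rightarrow> ('t, 'c) relmonad \<Rightarrow> ('t, 'c) relmonad \<Rightarrow> 'c set" where
  "relmonad_hom X j T T' =
     (let t = carrier T; t' = carrier T'
      in {\<tau> \<in> tight2 X t t'.
            tight2_comp X j t t' \<tau> (eta T) = eta T' \<and>
            gcomp X (hom_post X t t t' \<tau>) [ext T]
              = gcomp X (hom_pre X t t' t' \<tau>) [gcomp X (ext T') [hom_post X j t t' \<tau>]]})"

definition RMnd :: "('o, 't, 'l, 'c, 'm) vequip_scheme \<Rightarrow> 't \<Rightarrow> (('t, 'c) relmonad, 'c) cat" where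
  "RMnd X j =
     \<lparr> Ob = {T. is_relmonad X j T},
       Hom = relmonad_hom X j,
       Idm = (\<lambda>T. cap X (carrier T)),
       Cmp = (\<lambda>T T' T''. tight2_comp X (carrier T) (carrier T') (carrier T'')) \<rparr>"

record ('l, 'c) loosemonad =
  lcell :: 'l
  mult :: 'c
  unit :: 'c

definition is_loosemonad :: "('o, 't, 'l, 'c, 'm) vequip_scheme \<Rightarrow> 'o \<Rightarrow> ('l, 'c) loosemonad \<Rightarrow> bool" where
  "is_loosemonad X A S \<longleftrightarrow>
     (let s = lcell S; m = mult S; u = unit S
      in s \<in> looses X \<and> lsrc X s = A \<and> ltgt X s = A \<and>
         m \<in> glob X [s, s] s \<and> u \<in> glob X [] s \<and>
         gcomp X m [m, cid X s] = gcomp X m [cid X s, m] \<and>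
         gcomp X m [u, cid X s] = cid X s \<and> gcomp X m [cid X s, u] = cid X s)"

definition loosemonad_hom ::
    "('o, 't, 'l, 'c, 'm) vequip_scheme \<Rightarrow> ('l, 'c) loosemonad \<Rightarrow> ('l, 'c) loosemonad \<Rightarrow> 'c set" where
  "loosemonad_hom X S S' =
     {\<tau> \<in> glob X [lcell S] (lcell S').
        gcomp X \<tau> [unit S] = unit S' \<and> gcomp X \<tau> [mult S] = gcomp X (mult S') [\<tau>, \<tau>]}"

definition LMnd :: "('o, 't, 'l, 'c, 'm) vequip_scheme \<Rightarrow> 'o \<Rightarrow> (('l, 'c) loosemonad, 'c) cat" where
  "LMnd X A =
     \<lparr> Ob = {S. is_loosemonad X A S},
       Hom = loosemonad_hom X,
       Idm = (\<lambda>S. cid X (lcell S)),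
       Cmp = (\<lambda>S S' S'' d c. gcomp X d [c]) \<rparr>"


section \<open>The functors of the square\<close>

definition RMnd_forget :: "(('t, 'c) relmonad, 'c, 't, 'c) funct" where
  "RMnd_forget = \<lparr> fob = carrier, fmor = (\<lambda>T T' \<tau>. \<tau>) \<rparr>"

definition LMnd_forget :: "(('l, 'c) loosemonad, 'c, 'l, 'c) funct" where
  "LMnd_forget = \<lparr> fob = lcell, fmor = (\<lambda>S S' \<tau>. \<tau>) \<rparr>"

definition hom_functor :: "('o, 't, 'l, 'c, 'm) vequip_scheme \<Rightarrow> 't \<Rightarrow> ('t, 'c, 'l, 'c) funct" where
  "hom_functor X j = \<lparr> fob = hom X j, fmor = hom_post X j \<rparr>"

definition assoc_loosemonad ::
    "('o, 't, 'l, 'c, 'm) vequip_scheme \<Rightarrow> 't \<Rightarrow> ('t, 'c) relmonad \<Rightarrow> ('l, 'c) loosemonad" where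
  "assoc_loosemonad X j T =
     (let t = carrier T
      in \<lparr> lcell = hom X j t,
           mult = gcomp X (smile X j t t) [cid X (hom X j t), ext T],
           unit = gcomp X (hom_post X j j t (eta T)) [cap X j] \<rparr>)"

definition relmonad_functor ::
    "('o, 't, 'l, 'c, 'm) vequip_scheme \<Rightarrow> 't \<Rightarrow>
     (('t, 'c) relmonad, 'c, ('l, 'c) loosemonad, 'c) funct" where
  "relmonad_functor X j =
     \<lparr> fob = assoc_loosemonad X j,
       fmor = (\<lambda>T T'. hom_post X j (carrier T) (carrier T')) \<rparr>"

end

theory Submission
  imports Defs
begin

text \<open>
  A globular 2-cell \<open>ps \<Rightarrow> E(x,y)\<close> is the same as a 2-cell from \<open>ps\<close> to \<open>E(1,1)\<close> with left \<open>x\<close> and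
  right \<open>y\<close>. On the latter, the composition 2-cells \<open>\<smile>\<close> become an associative product \<open>\<star>\<close>, whose
  units \<open>U x\<close> correspond to \<open>\<frown>\<^sub>x\<close>, and which commutes with precomposition by rows. Writing
  \<open>h : E(j,t)\<close>, \<open>e\<close>, \<open>n\<close> for the 2-cells into \<open>E(1,1)\<close> corresponding to \<open>1\<close>, \<open>\<dagger>\<close> and \<open>\<eta>\<close>, the
  relative monad laws read \<open>n \<star> e = h\<close>, \<open>e[\<eta>] = U t\<close> and \<open>e \<star> e = e[\<mu>]\<close>, where \<open>\<mu>\<close> corresponds
  to \<open>h \<star> e\<close>. The loose-monad laws for \<open>E(j,t)\<close> are the first of these equations together with
  \<open>h \<star> _\<close> applied to the other two, and similarly for morphisms.

  Density of \<open>j\<close> implies that \<open>h \<star> _\<close> is bijective. So the laws become equivalent, every multiplication on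
  \<open>E(j,t)\<close> is \<open>h \<star> e\<close> for a unique \<open>e\<close>, and every 2-cell \<open>E(j,t) \<Rightarrow> E(j,t')\<close> is \<open>h \<star> \<tau>\<close> for a unique \<open>\<tau>\<close>.
\<close>

section \<open>Rows of 2-cells\<close>

lemma (in virtual_double_category) tcomp_tid [simp]:
  assumes "f \<in> tights X"
  shows "tdom X f = A \<Longrightarrow> tcomp X f (tid X A) = f" and "tcod X f = B \<Longrightarrow> tcomp X (tid X B) f = f"
  using assms tid_right tid_left by auto

lemma (in virtual_double_category) chain_objs:
  "chain X A ps B \<Longrightarrow> A \<in> objs X \<and> B \<in> objs X"
  by (induction ps arbitrary: A) (auto dest: ltgt_in)

lemma (in virtual_double_category) chain_append:
  "chain X A (ps @ qs) C \<longleftrightarrow> (\<exists>B. chain X A ps B \<and> chain X B qs C)"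
  by (induction ps arbitrary: A) (use chain_objs in auto)

lemma (in virtual_double_category) cid_row:
  "chain X A ps B \<Longrightarrow> row X (tid X A) (map (cid X) ps)"
  "chain X A ps B \<Longrightarrow> row_right X (tid X A) (map (cid X) ps) = tid X B"
  "chain X A ps B \<Longrightarrow> map (ccod X) (map (cid X) ps) = ps"
  "chain X A ps B \<Longrightarrow> concat (map (cdom X) (map (cid X) ps)) = ps"
  by (induction ps arbitrary: A) (auto simp: tid_in cid_in)

lemma (in virtual_double_category) row_tights:
  "row X f cs \<Longrightarrow> f \<in> tights X \<and> row_right X f cs \<in> tights X"
proof (induction cs arbitrary: f)
  case (Cons c cs)
  then show ?case
    using cell_frame[of c] by auto
qed simp

lemma (in virtual_double_category) row_append:
  "row X f (cs @ ds) \<longleftrightarrow> row X f cs \<and> row X (row_right X f cs) ds"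
  by (induction cs arbitrary: f) (use row_tights in auto)

lemma row_right_append: "row_right X f (cs @ ds) = row_right X (row_right X f cs) ds"
  by (induction cs arbitrary: f) auto

text \<open>Every identity has a domain of length one, so the members of \<open>ds\<close> are
  paired off one at a time and each is absorbed by \<open>cid_left\<close>.\<close>

lemma (in virtual_double_category) distribute_cid:
  "row X f ds \<Longrightarrow> map (ccod X) ds = ps \<Longrightarrow> distribute X f (map (cid X) ps) ds = ds"
proof (induction ds arbitrary: f ps)
  case (Cons d ds)
  then show ?case
    using cell_frame[of d] cid_in[of "ccod X d"] cid_left[of d] by (auto simp del: map_map)
qed simp

text \<open>Associativity for a middle row of two 2-cells. The upper row is given already split at
  the arities of \<open>a\<close> and \<open>b\<close>, so that \<open>distribute\<close>
  disappears; its second part starts at the right boundary of \<open>cs\<close>.\<close>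

lemma (in virtual_double_category) ccomp_assoc2:
  assumes "composable X c f [a, b]" and "composable X (ccomp X c f [a, b]) h (cs @ ds)"
    and "length cs = length (cdom X a)" "length ds = length (cdom X b)"
  shows "ccomp X (ccomp X c f [a, b]) h (cs @ ds)
    = ccomp X c (tcomp X f h) [ccomp X a h cs, ccomp X b (row_right X h cs) ds]"
  using ccomp_assoc[OF assms(1,2)] assms(3,4) by (simp add: Let_def)

lemma (in virtual_double_category) ccomp_assoc1:
  assumes "composable X c f [a]" and "composable X (ccomp X c f [a]) h cs"
    and "length cs = length (cdom X a)"
  shows "ccomp X (ccomp X c f [a]) h cs = ccomp X c (tcomp X f h) [ccomp X a h cs]"
  using ccomp_assoc[OF assms(1,2)] assms(3) by (simp add: Let_def)

section \<open>The calculus of 2-cells into a loose-identity\<close>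

locale hom_calculus = virtual_equipment X
  for X :: "('o, 't, 'l, 'c, 'm) vequip_scheme" +
  fixes E :: 'o
  assumes E: "E \<in> objs X"
begin

abbreviation I where "I \<equiv> lid X E"
abbreviation u where "u \<equiv> unit_cell X E"
abbreviation one where "one \<equiv> tid X E"

definition over :: "'t \<Rightarrow> bool" where
  "over x \<longleftrightarrow> x \<in> tights X \<and> tcod X x = E"

definition K :: "'l list \<Rightarrow> 't \<Rightarrow> 't \<Rightarrow> 'c set" where
  "K ps x y = {d \<in> cells X. cdom X d = ps \<and> ccod X d = I \<and> cleft X d = x \<and> cright X d = y}"

text \<open>The multiplication is the canonical 2-cell \<open>I, I \<Rightarrow> I\<close>. The row
  starts at the left boundary of \<open>d\<close>, which thereby becomes the left boundary of the
  product.\<close>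

definition star :: "'c \<Rightarrow> 'c \<Rightarrow> 'c"  (infixl "\<star>" 70) where
  "d \<star> e = ccomp X (runitor X I) (cleft X d) [d, e]"

text \<open>An empty row carries no boundary of its own, so \<open>x\<close> is passed explicitly:
  this is the nullary 2-cell \<open>u\<close> precomposed with the tight-cell
  \<open>x\<close>.\<close>

definition U :: "'t \<Rightarrow> 'c" where
  "U x = ccomp X u x []"

lemma over_one [simp]: "over one"
  using E tid_in by (simp add: over_def)

lemma unit_cell_E: "u \<in> cells X" "cdom X u = []" "ccod X u = I" "cleft X u = one" "cright X u = one"
    "opcartesian X u"
  using unit_cell[OF E] by (auto simp: opcartesian_def glob_def lid_def)

lemma lid_E: "I \<in> looses X" "ltgt X I = E" "lsrc X I = E"
  using unit_cell_E cell_frame[of u] unit_cell[OF E] by (auto simp: lid_def)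

text \<open>Opcartesianness of \<open>u\<close> read with its empty domain. The chain hypothesis is
  what places the new \<open>I\<close> at the object \<open>E\<close>, between \<open>ps\<close> and
  \<open>rs\<close>.\<close>

lemma unit_factor:
  assumes "d \<in> cells X" "cdom X d = ps @ rs" "chain X (tdom X (cleft X d)) ps E"
  shows "\<exists>!e. e \<in> cells X \<and> cdom X e = ps @ [I] @ rs \<and> ccod X e = ccod X d \<and>
     cleft X e = cleft X d \<and> cright X e = cright X d \<and>
     gcomp X e (map (cid X) ps @ [u] @ map (cid X) rs) = d"
proof -
  have "\<forall>d ps rs. d \<in> cells X \<and> cdom X d = ps @ rs \<and> chain X (tdom X (cleft X d)) ps E \<longrightarrow>
    (\<exists>!e. e \<in> cells X \<and> cdom X e = ps @ [I] @ rs \<and> ccod X e = ccod X d \<and>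
     cleft X e = cleft X d \<and> cright X e = cright X d \<and>
     gcomp X e (map (cid X) ps @ [u] @ map (cid X) rs) = d)"
    using unit_cell_E(6) unfolding opcartesian_def unit_cell_E(2,3) lid_E(2) append_Nil by blast
  then show ?thesis
    using assms by blast
qed

lemma runitor:
  assumes "p \<in> looses X" "lsrc X p = E"
  shows "runitor X p \<in> glob X [p, I] p" "gcomp X (runitor X p) [cid X p, u] = cid X p"
proof -
  have "\<exists>!e. e \<in> glob X [p, I] p \<and> gcomp X e [cid X p, u] = cid X p"
    using unit_factor[of "cid X p" "[p]" "[]"] assms cid_in[of p] tid_in ltgt_in[of p] E
    by (simp add: glob_def conj_assoc)
  from theI'[OF this] show "runitor X p \<in> glob X [p, I] p" "gcomp X (runitor X p) [cid X p, u] = cid X p"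
    by (simp_all add: runitor_def assms(2))
qed

text \<open>The uniqueness half of opcartesianness. Equations between 2-cells whose domain ends in
  \<open>I\<close> are proved below by inserting \<open>u\<close> there.\<close>

lemma unit_cancel:
  assumes "e \<in> cells X" "e' \<in> cells X" "cdom X e = ps @ [I]" "cdom X e' = ps @ [I]"
    "ccod X e = ccod X e'" "cleft X e = cleft X e'" "cright X e = cright X e'"
    "gcomp X e (map (cid X) ps @ [u]) = gcomp X e' (map (cid X) ps @ [u])"
  shows "e = e'"
proof -
  let ?A = "tdom X (cleft X e)"
  let ?d = "gcomp X e (map (cid X) ps @ [u])"
  have "chain X ?A (ps @ [I]) (tdom X (cright X e))"
    using cell_frame[OF assms(1)] assms(3) by simp
  then have ch: "chain X ?A ps E" "tdom X (cright X e) = E" "cright X e \<in> tights X"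
    "cleft X e \<in> tights X"
    using lid_E cell_frame[OF assms(1)] by (auto simp: chain_append)
  have comp: "composable X e (tid X ?A) (map (cid X) ps @ [u])"
    using cid_row[OF ch(1)] ch(2-4) assms(1,3) unit_cell_E(1-5) tid_in[OF tdom_in[OF ch(4)]]
      tid_in[OF E]
    by (simp add: composable_def row_append row_right_append)
  have "concat (map (cdom X) (map (cid X) ps @ [u])) = ps"
    using cid_row[OF ch(1)] unit_cell_E by simp
  moreover have "row_right X (tid X ?A) (map (cid X) ps @ [u]) = one"
    using unit_cell_E by (simp add: row_right_append)
  ultimately have d: "?d \<in> cells X" "cdom X ?d = ps" "ccod X ?d = ccod X e" "cleft X ?d = cleft X e"
    "cright X ?d = cright X e"
    using ccomp_in[OF comp] ch(2-4) by (simp_all add: gcomp_def del: map_append)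
  then have ex: "\<exists>!e'. e' \<in> cells X \<and> cdom X e' = ps @ [I] @ [] \<and> ccod X e' = ccod X e \<and>
     cleft X e' = cleft X e \<and> cright X e' = cright X e \<and>
     gcomp X e' (map (cid X) ps @ [u] @ map (cid X) []) = ?d"
    using unit_factor[of ?d ps "[]"] ch(1) by (simp only: d) simp
  show ?thesis
    by (rule ex1E[OF ex]) (metis assms append_Nil2 list.map(1))
qed

lemma tid_E: "one \<in> tights X" "tdom X one = E" "tcod X one = E"
  using tid_in[OF E] by auto

lemma cid_I: "cid X I \<in> cells X" "cdom X (cid X I) = [I]" "ccod X (cid X I) = I"
    "cleft X (cid X I) = one" "cright X (cid X I) = one"
  using cid_in[OF lid_E(1)] lid_E by auto

section \<open>The loose-identity \<open>I\<close> as a monoid with multiplication \<open>m\<close>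
  and unit \<open>u\<close>\<close>

abbreviation m where "m \<equiv> runitor X I"

lemma runitor_lid: "m \<in> cells X" "cdom X m = [I, I]" "ccod X m = I" "cleft X m = one" "cright X m = one"
    "ccomp X m one [cid X I, u] = cid X I"
  using runitor[OF lid_E(1,3)] lid_E tid_E by (auto simp: glob_def gcomp_def)

lemmas frames = unit_cell_E(1-5) tid_E cid_I runitor_lid(1-5) lid_E

lemma ccomp_frame:
  assumes "composable X c f cs"
  shows "ccomp X c f cs \<in> cells X" "cdom X (ccomp X c f cs) = concat (map (cdom X) cs)"
    "ccod X (ccomp X c f cs) = ccod X c" "cleft X (ccomp X c f cs) = tcomp X (cleft X c) f"
    "cright X (ccomp X c f cs) = tcomp X (cright X c) (row_right X f cs)"
  using ccomp_in[OF assms] by auto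

lemma cid_ccomp: "c \<in> cells X \<Longrightarrow> ccod X c = p \<Longrightarrow> cleft X c = f \<Longrightarrow> ccomp X (cid X p) f [c] = c"
  using cid_left by auto

text \<open>The definition of \<open>m\<close> only provides the right unit law
  \<open>m[1,u] = 1\<close>. With \<open>u\<close> inserted in the remaining slot,
  \<open>m[u,1]\<close> and \<open>m[1,u]\<close> both become \<open>m[u,u]\<close>, so the left
  unit law follows by cancelling \<open>u\<close>.\<close>

lemma m_unit_left: "ccomp X m one [u, cid X I] = cid X I"
proof (rule unit_cancel[where ps = "[]"])
  have "ccomp X (ccomp X m one [u, cid X I]) one ([] @ [u]) = ccomp X m one [u, u]"
    using cid_right[OF unit_cell_E(1)]
    by (subst ccomp_assoc2) (simp_all add: composable_def ccomp_frame frames cid_ccomp)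
  also have "\<dots> = ccomp X (ccomp X m one [cid X I, u]) one ([u] @ [])"
    using cid_right[OF unit_cell_E(1)]
    by (subst ccomp_assoc2) (simp_all add: composable_def ccomp_frame frames cid_ccomp)
  finally show "gcomp X (ccomp X m one [u, cid X I]) (map (cid X) [] @ [u])
      = gcomp X (cid X I) (map (cid X) [] @ [u])"
    by (simp add: composable_def ccomp_frame frames gcomp_def runitor_lid(6))
qed (simp_all add: composable_def ccomp_frame frames)

text \<open>With \<open>u\<close> inserted in the last slot both sides reduce to \<open>m\<close>:
  on the left through \<open>m[m,u] = (m[1,u])[m]\<close>, on the right through
  \<open>m[1,m[1,u]] = m[1,1]\<close>.\<close>

lemma m_assoc: "ccomp X m one [m, cid X I] = ccomp X m one [cid X I, m]"
proof (rule unit_cancel[where ps = "[I, I]"])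
  have "ccomp X (ccomp X m one [m, cid X I]) one ([cid X I, cid X I] @ [u]) = ccomp X m one [m, u]"
    using cid_right[OF runitor_lid(1)]
    by (subst ccomp_assoc2) (simp_all add: composable_def ccomp_frame frames cid_ccomp)
  also have "\<dots> = ccomp X (ccomp X m one [cid X I, u]) one ([m] @ [])"
    using cid_right[OF unit_cell_E(1)]
    by (subst ccomp_assoc2) (simp_all add: composable_def ccomp_frame frames cid_ccomp)
  also have "\<dots> = m"
    by (simp add: runitor_lid(6) cid_ccomp frames)
  also have "m = ccomp X m one [cid X I, cid X I]"
    using cid_right[OF runitor_lid(1)] by (simp add: frames)
  also have "\<dots> = ccomp X (ccomp X m one [cid X I, m]) one ([cid X I] @ [cid X I, u])"
    by (subst ccomp_assoc2) (simp_all add: composable_def ccomp_frame frames cid_ccomp runitor_lid(6))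
  finally show "gcomp X (ccomp X m one [m, cid X I]) (map (cid X) [I, I] @ [u])
      = gcomp X (ccomp X m one [cid X I, m]) (map (cid X) [I, I] @ [u])"
    by (simp add: composable_def ccomp_frame frames gcomp_def)
qed (simp_all add: composable_def ccomp_frame frames)

section \<open>The product on 2-cells into the loose-identity\<close>

lemma K_D:
  assumes "d \<in> K ps x y"
  shows "d \<in> cells X" "cdom X d = ps" "ccod X d = I" "cleft X d = x" "cright X d = y"
    "over x" "over y" "chain X (tdom X x) ps (tdom X y)" "x \<in> tights X" "y \<in> tights X"
    "tcod X x = E" "tcod X y = E"
proof -
  have c: "d \<in> cells X" "cdom X d = ps" "ccod X d = I" "cleft X d = x" "cright X d = y"
    using assms by (simp_all add: K_def)
  have "tcod X (cleft X d) = ltgt X (ccod X d)" "tcod X (cright X d) = lsrc X (ccod X d)"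
    using cell_frame[OF c(1)] by simp_all
  then show t: "tcod X x = E" "tcod X y = E"
    by (simp_all add: c lid_E)
  show "x \<in> tights X" "y \<in> tights X" "chain X (tdom X x) ps (tdom X y)"
    using cell_frame[OF c(1)] by (simp_all add: c(2-5))
  with t show "over x" "over y"
    by (simp_all add: over_def)
  show "d \<in> cells X" "cdom X d = ps" "ccod X d = I" "cleft X d = x" "cright X d = y"
    by fact+
qed

lemma U_in: "over x \<Longrightarrow> U x \<in> K [] x x"
  by (simp add: K_def U_def composable_def ccomp_frame frames over_def)

lemma star_in:
  assumes "d \<in> K ps x y" "e \<in> K qs y z"
  shows "d \<star> e \<in> K (ps @ qs) x z"
  unfolding K_def star_def using K_D[OF assms(1)] K_D[OF assms(2)]
  by (simp add: composable_def ccomp_frame frames)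

lemma ccomp_in_K:
  assumes "d \<in> K ps x y" "row X f cs" "map (ccod X) cs = ps" "tcod X f = tdom X x"
  shows "ccomp X d f cs \<in> K (concat (map (cdom X) cs)) (tcomp X x f) (tcomp X y (row_right X f cs))"
  unfolding K_def using K_D[OF assms(1)] assms(2-4) by (simp add: composable_def ccomp_frame)

text \<open>This is associativity below the row \<open>d, e\<close>, with \<open>m\<close> at the
  bottom. The tight boundaries of \<open>cs\<close> and \<open>ds\<close> are arbitrary because
  \<open>dense_bij\<close> precomposes with 2-cells that are not globular.\<close>

lemma star_row:
  assumes "d \<in> K ps x y" "e \<in> K qs y z" "row X f (cs @ ds)" "map (ccod X) cs = ps"
    "map (ccod X) ds = qs" "tcod X f = tdom X x"
  shows "ccomp X (d \<star> e) f (cs @ ds) = ccomp X d f cs \<star> ccomp X e (row_right X f cs) ds"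
proof -
  note d = K_D[OF assms(1)] and e = K_D[OF assms(2)]
  have c: "composable X m x [d, e]"
    using d e by (simp add: composable_def frames)
  have len: "length cs = length ps" "length ds = length qs"
    using assms(4,5) by auto
  have "composable X d f cs"
    using assms(3,4,6) d by (simp add: composable_def row_append)
  then have cl: "cleft X (ccomp X d f cs) = tcomp X x f"
    using d by (simp add: ccomp_frame)
  show ?thesis
    unfolding star_def d
    using len cl assms(3-6) d e
    by (subst ccomp_assoc2[OF c])
      (simp_all add: composable_def ccomp_frame[OF c] frames)
qed

text \<open>The unit and associativity laws of \<open>\<star>\<close> are those of \<open>m\<close>,
  precomposed with a row of one or three 2-cells.\<close>

lemma U_star: "d \<in> K ps x y \<Longrightarrow> U x \<star> d = d"
proof -
  assume d: "d \<in> K ps x y"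
  note d = d K_D[OF d]
  have "ccomp X (ccomp X m one [u, cid X I]) x ([] @ [d]) = U x \<star> d"
    using d by (subst ccomp_assoc2)
      (simp_all add: composable_def ccomp_frame frames cid_ccomp star_def U_def)
  then show ?thesis
    using d by (simp add: m_unit_left cid_ccomp)
qed

lemma star_U: "d \<in> K ps x y \<Longrightarrow> d \<star> U y = d"
proof -
  assume d: "d \<in> K ps x y"
  note d = d K_D[OF d]
  have "ccomp X (ccomp X m one [cid X I, u]) x ([d] @ []) = d \<star> U y"
    using d by (subst ccomp_assoc2)
      (simp_all add: composable_def ccomp_frame frames cid_ccomp star_def U_def)
  then show ?thesis
    using d by (simp add: runitor_lid cid_ccomp)
qed

lemma star_assoc:
  assumes "d \<in> K ps x y" "e \<in> K qs y z" "f \<in> K rs z w"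
  shows "d \<star> e \<star> f = d \<star> (e \<star> f)"
proof -
  note d = K_D[OF assms(1)] and e = K_D[OF assms(2)] and f = K_D[OF assms(3)]
  have "ccomp X (ccomp X m one [m, cid X I]) x ([d, e] @ [f]) = d \<star> e \<star> f"
    using d e f by (subst ccomp_assoc2)
      (simp_all add: composable_def ccomp_frame frames cid_ccomp star_def)
  moreover have "ccomp X (ccomp X m one [cid X I, m]) x ([d] @ [e, f]) = d \<star> (e \<star> f)"
    using d e f by (subst ccomp_assoc2)
      (simp_all add: composable_def ccomp_frame frames cid_ccomp star_def)
  ultimately show ?thesis
    by (simp add: m_assoc)
qed

section \<open>Flattening: globular 2-cells into \<open>E(x,y)\<close> as 2-cells into
  \<open>E(1,1)\<close>\<close>

definition flat :: "'t \<Rightarrow> 't \<Rightarrow> 'c \<Rightarrow> 'c" where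
  "flat x y c = ccomp X (hom_cell X x y) (tid X (tdom X x)) [c]"

abbreviation h where "h \<equiv> hom_cell X"

lemma hom_cell:
  assumes "over x" "over y"
  shows "h x y \<in> K [hom X x y] x y" "hom X x y \<in> looses X"
    "ltgt X (hom X x y) = tdom X x" "lsrc X (hom X x y) = tdom X y"
    "cartesian X (h x y)"
proof -
  have *: "cartesian X (h x y)" "ccod X (h x y) = I" "cleft X (h x y) = x" "cright X (h x y) = y"
    using restr_cell[of I x y] assms lid_E by (auto simp: hom_cell_def over_def)
  then have "h x y \<in> cells X" "length (cdom X (h x y)) = 1"
    by (auto simp: cartesian_def)
  moreover from this have "cdom X (h x y) = [hom X x y]"
    using assms by (auto simp: hom_def restr_def hom_cell_def over_def length_Suc_conv)
  ultimately show "h x y \<in> K [hom X x y] x y"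
    using * by (simp add: K_def)
  from K_D[OF this] show "hom X x y \<in> looses X" "ltgt X (hom X x y) = tdom X x"
      "lsrc X (hom X x y) = tdom X y"
    by auto
  show "cartesian X (h x y)"
    by (fact *)
qed

text \<open>The cartesian property with arbitrary \<open>f\<close> and \<open>g\<close>. Identities
  give \<open>flat_factor\<close>; other boundaries produce the auxiliary 2-cells in
  \<open>dense_bij\<close>.\<close>

lemma hom_cell_factor:
  assumes "over x" "over y" "f \<in> tights X" "g \<in> tights X" "tcod X f = tdom X x" "tcod X g = tdom X y"
    "d \<in> K ps (tcomp X x f) (tcomp X y g)"
  shows "\<exists>!e. e \<in> cells X \<and> cdom X e = ps \<and> ccod X e = hom X x y \<and> cleft X e = f \<and>
     cright X e = g \<and> ccomp X (h x y) f [e] = d"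
proof -
  note h = K_D[OF hom_cell(1)[OF assms(1,2)]] and d = K_D[OF assms(7)]
  have "\<forall>d f g. d \<in> cells X \<and> ccod X d = I \<and> f \<in> tights X \<and> g \<in> tights X \<and>
              tcod X f = tdom X x \<and> tcod X g = tdom X y \<and>
              cleft X d = tcomp X x f \<and> cright X d = tcomp X y g \<longrightarrow>
        (\<exists>!e. e \<in> cells X \<and> cdom X e = cdom X d \<and> ccod X e = hom X x y \<and>
              cleft X e = f \<and> cright X e = g \<and> ccomp X (h x y) f [e] = d)"
    using hom_cell(5)[OF assms(1,2)] unfolding cartesian_def h list.sel by blast
  from this[rule_format, of d f g] show ?thesis
    using d assms by simp
qed

lemma glob_hom:
  assumes "over x" "over y"
  shows "c \<in> glob X ps (hom X x y) \<longleftrightarrow> c \<in> cells X \<and> cdom X c = ps \<and> ccod X c = hom X x y \<and>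
    cleft X c = tid X (tdom X x) \<and> cright X c = tid X (tdom X y)"
  by (auto simp: glob_def hom_cell[OF assms])

lemma flat_factor:
  assumes "d \<in> K ps x y"
  shows "\<exists>!e. e \<in> glob X ps (hom X x y) \<and> flat x y e = d"
  using hom_cell_factor[of x y "tid X (tdom X x)" "tid X (tdom X y)" d ps] assms K_D[OF assms]
    tid_in[OF tdom_in[OF K_D(9)[OF assms]]] tid_in[OF tdom_in[OF K_D(10)[OF assms]]]
  by (simp add: glob_hom flat_def conj_assoc)

lemma flat_in:
  assumes "over x" "over y" "c \<in> glob X ps (hom X x y)"
  shows "flat x y c \<in> K ps x y"
proof -
  note h = hom_cell(1)[OF assms(1,2)]
  show ?thesis
    using ccomp_in_K[OF h, of "tid X (tdom X x)" "[c]"] assms K_D[OF h]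
      tid_in[OF tdom_in[OF K_D(9)[OF h]]] tid_in[OF tdom_in[OF K_D(10)[OF h]]]
    by (simp add: glob_hom flat_def)
qed

lemma flat_inject:
  assumes "over x" "over y" "c \<in> glob X ps (hom X x y)" "c' \<in> glob X ps (hom X x y)"
    "flat x y c = flat x y c'"
  shows "c = c'"
  by (rule ex1E[OF flat_factor[OF flat_in[OF assms(1,2,3)]]]) (metis assms(3,4,5))

text \<open>By \<open>flat_factor\<close> the definite description is well defined, which makes
  \<open>hom_factor\<close> inverse to \<open>flat\<close>.\<close>

lemma hom_factor:
  assumes "d \<in> K ps x y"
  shows "hom_factor X x y d \<in> glob X ps (hom X x y)" "flat x y (hom_factor X x y d) = d"
proof -
  note d = K_D[OF assms]
  have eq: "hom_factor X x y d = (THE e. e \<in> glob X ps (hom X x y) \<and> flat x y e = d)"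
    using K_D(4)[OF hom_cell(1)[OF d(6,7)]] d(2) by (simp add: hom_factor_def flat_def gcomp_def)
  show "hom_factor X x y d \<in> glob X ps (hom X x y)" "flat x y (hom_factor X x y d) = d"
    unfolding eq using theI'[OF flat_factor[OF assms]] by blast+
qed

lemma cap:
  assumes "over x"
  shows "cap X x \<in> glob X [] (hom X x x)" "flat x x (cap X x) = U x"
  using hom_factor[OF U_in[OF assms]] assms by (simp_all add: cap_def U_def over_def)

lemma smile:
  assumes "over x" "over y" "over z"
  shows "smile X x y z \<in> glob X [hom X x y, hom X y z] (hom X x z)"
    "flat x z (smile X x y z) = h x y \<star> h y z"
  using hom_factor[OF star_in[OF hom_cell(1)[OF assms(1,2)] hom_cell(1)[OF assms(2,3)]]] assms
    K_D(4)[OF hom_cell(1)[OF assms(1,2)]]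
  by (simp_all add: smile_def star_def over_def)

lemma flat_gcomp:
  assumes "over x" "over y" "c \<in> glob X ps (hom X x y)" "row X (tid X (tdom X x)) cs"
    "map (ccod X) cs = ps"
  shows "flat x y (gcomp X c cs) = gcomp X (flat x y c) cs"
proof -
  note h = K_D[OF hom_cell(1)[OF assms(1,2)]]
  note t = tid_in[OF tdom_in[OF h(9)]] tid_in[OF tdom_in[OF h(10)]]
  note f = K_D[OF flat_in[OF assms(1-3)]]
  have "length cs = length ps"
    using assms(5) by auto
  then show ?thesis
    using assms h t f
    unfolding flat_def gcomp_def
    by (subst ccomp_assoc1) (simp_all add: composable_def glob_hom)
qed

section \<open>Density\<close>

lemma flat_cid:
  assumes "over x" "over y"
  shows "cid X (hom X x y) \<in> glob X [hom X x y] (hom X x y)" "flat x y (cid X (hom X x y)) = h x y"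
proof -
  note h = hom_cell[OF assms]
  show "cid X (hom X x y) \<in> glob X [hom X x y] (hom X x y)"
    using cid_in[OF h(2)] by (simp add: glob_def)
  show "flat x y (cid X (hom X x y)) = h x y"
    using cid_right[OF K_D(1)[OF h(1)]] K_D(2,4)[OF h(1)] by (simp add: flat_def)
qed

text \<open>Relates the canonical 2-cell \<open>E(x,1), E(1,1) \<Rightarrow> E(x,1)\<close>, which
  occurs in the definition of density, to \<open>m\<close>. Each is characterised by a right unit
  law, so after inserting \<open>u\<close> both sides become \<open>h x one\<close>.\<close>

lemma hom_runitor:
  assumes "over x"
  shows "ccomp X (h x one) (tid X (tdom X x)) [runitor X (hom X x one)]
    = ccomp X m x [h x one, cid X I]"
proof (rule unit_cancel[where ps = "[hom X x one]"])
  let ?J = "hom X x one"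
  note J = hom_cell[OF assms over_one] and h = K_D[OF hom_cell(1)[OF assms over_one]]
  have lJ: "lsrc X ?J = E"
    using J(4) tid_E by simp
  note t = tid_in[OF tdom_in[OF h(9)]]
  note c = cid_in[OF J(2)]
  have r: "runitor X ?J \<in> cells X" "cdom X (runitor X ?J) = [?J, I]" "ccod X (runitor X ?J) = ?J"
    "cleft X (runitor X ?J) = tid X (tdom X x)" "cright X (runitor X ?J) = one"
    "ccomp X (runitor X ?J) (tid X (tdom X x)) [cid X ?J, u] = cid X ?J"
    using runitor[OF J(2) lJ] J t lJ by (simp_all add: glob_def gcomp_def)
  have c1: "composable X (h x one) (tid X (tdom X x)) [runitor X ?J]"
    using h r t by (simp add: composable_def frames)
  have c2: "composable X m x [h x one, cid X I]"
    using h by (simp add: composable_def frames)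
  note f1 = ccomp_frame[OF c1] and f2 = ccomp_frame[OF c2]
  have "ccomp X (ccomp X (h x one) (tid X (tdom X x)) [runitor X ?J]) (tid X (tdom X x)) [cid X ?J, u]
      = h x one"
    using h r t c J lJ cid_right[OF h(1)]
    by (subst ccomp_assoc1[OF c1]) (simp_all add: composable_def f1 frames)
  moreover have "ccomp X (ccomp X m x [h x one, cid X I]) (tid X (tdom X x)) ([cid X ?J] @ [u])
      = ccomp X (ccomp X m one [cid X I, u]) x ([h x one] @ [])"
    using h t c J lJ cid_right[OF h(1)] cid_right[OF unit_cell_E(1)]
    by (subst (1 2) ccomp_assoc2) (simp_all add: composable_def ccomp_frame frames cid_ccomp)
  ultimately show "gcomp X (ccomp X (h x one) (tid X (tdom X x)) [runitor X ?J]) (map (cid X) [?J] @ [u])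
      = gcomp X (ccomp X m x [h x one, cid X I]) (map (cid X) [?J] @ [u])"
    using h t by (simp add: gcomp_def f1 f2 frames runitor_lid(6) cid_ccomp)
  show "ccomp X (h x one) (tid X (tdom X x)) [runitor X ?J] \<in> cells X"
    "ccomp X m x [h x one, cid X I] \<in> cells X"
    "cdom X (ccomp X (h x one) (tid X (tdom X x)) [runitor X ?J]) = [?J] @ [I]"
    "cdom X (ccomp X m x [h x one, cid X I]) = [?J] @ [I]"
    "ccod X (ccomp X (h x one) (tid X (tdom X x)) [runitor X ?J]) = ccod X (ccomp X m x [h x one, cid X I])"
    "cleft X (ccomp X (h x one) (tid X (tdom X x)) [runitor X ?J]) = cleft X (ccomp X m x [h x one, cid X I])"
    "cright X (ccomp X (h x one) (tid X (tdom X x)) [runitor X ?J]) = cright X (ccomp X m x [h x one, cid X I])"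
    using h r t by (simp_all add: f1 f2 frames)
qed

lemma glob_I: "glob X ps I = K ps one one"
  by (simp add: glob_def K_def lid_E)

text \<open>The assignment \<open>\<phi> \<mapsto> (1, \<phi>)\<close> of the definition of density
  thus becomes multiplication by \<open>h x one\<close> on the left.\<close>

lemma flat_runitor:
  assumes "over x" "\<phi> \<in> K rs one one"
  shows "flat x one (gcomp X (runitor X (hom X x one)) [cid X (hom X x one), \<phi>]) = h x one \<star> \<phi>"
proof -
  let ?J = "hom X x one"
  note J = hom_cell[OF assms(1) over_one] and h = K_D[OF hom_cell(1)[OF assms(1) over_one]]
  note f = K_D[OF assms(2)]
  have lJ: "lsrc X ?J = E"
    using J(4) tid_E by simp
  note t = tid_in[OF tdom_in[OF h(9)]]
  note c = cid_in[OF J(2)]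
  have r: "runitor X ?J \<in> cells X" "cdom X (runitor X ?J) = [?J, I]" "ccod X (runitor X ?J) = ?J"
    "cleft X (runitor X ?J) = tid X (tdom X x)" "cright X (runitor X ?J) = one"
    using runitor[OF J(2) lJ] J t lJ by (simp_all add: glob_def gcomp_def)
  have "flat x one (gcomp X (runitor X ?J) [cid X ?J, \<phi>])
      = ccomp X (ccomp X (h x one) (tid X (tdom X x)) [runitor X ?J]) (tid X (tdom X x)) [cid X ?J, \<phi>]"
    unfolding flat_def using h r t c J lJ f
    by (subst ccomp_assoc1) (simp_all add: composable_def ccomp_frame frames gcomp_def)
  also have "\<dots> = ccomp X (ccomp X m x [h x one, cid X I]) (tid X (tdom X x)) ([cid X ?J] @ [\<phi>])"
    by (simp add: hom_runitor[OF assms(1)])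
  also have "\<dots> = h x one \<star> \<phi>"
    using h t c J lJ f cid_right[OF h(1)]
    by (subst ccomp_assoc2) (simp_all add: composable_def ccomp_frame frames cid_ccomp star_def)
  finally show ?thesis .
qed

lemma flat_bij:
  assumes "over x" "over y"
  shows "bij_betw (flat x y) (glob X ps (hom X x y)) (K ps x y)"
  unfolding bij_betw_def
proof
  show "inj_on (flat x y) (glob X ps (hom X x y))"
    by (intro inj_onI) (rule flat_inject[OF assms])
  show "flat x y ` glob X ps (hom X x y) = K ps x y"
    using flat_in[OF assms] hom_factor by (force simp: image_iff)
qed

text \<open>The defining bijection of density followed by the bijection \<open>flat\<close>; it is
  the case of \<open>dense_bij\<close> in which both boundaries are \<open>one\<close>.\<close>

lemma dense_star:
  assumes "over j" "dense X j" "chain X E rs E"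
  shows "bij_betw (\<lambda>\<phi>. h j one \<star> \<phi>) (K rs one one) (K (hom X j one # rs) j one)"
proof -
  have "bij_betw (\<lambda>\<phi>. gcomp X (runitor X (hom X j one)) [cid X (hom X j one), \<phi>])
      (K rs one one) (glob X (hom X j one # rs) (hom X j one))"
    using assms by (simp add: dense_def over_def Let_def glob_I)
  from bij_betw_trans[OF this flat_bij[OF assms(1) over_one]] show ?thesis
    by (rule bij_betw_cong[THEN iffD1, rotated]) (simp add: flat_runitor[OF assms(1)])
qed

text \<open>
  The hypothesis only concerns chains from \<open>E\<close> to \<open>E\<close>. The chain \<open>ps\<close> is extended to
  \<open>E(1,x), ps, E(y,1)\<close> by \<open>h 1 x \<star> _ \<star> h y 1\<close>, and one returns by precomposing with the
  nullary 2-cells \<open>cx\<close>, \<open>cy\<close> into \<open>E(1,x)\<close> and \<open>E(y,1)\<close> that have a nontrivial left, respectively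
  right, boundary. The 2-cell \<open>r : E(j,x) \<Rightarrow> E(j,1)\<close> with right \<open>x\<close> matches the boundary of \<open>cx\<close>.
\<close>

lemma dense_bij:
  assumes "over j" "over x" "over y" "dense X j" "chain X (tdom X x) ps (tdom X y)"
  shows "bij_betw (\<lambda>\<phi>. h j x \<star> \<phi>) (K ps x y) (K (hom X j x # ps) j y)"
proof -
  define A B D where ABD: "A = tid X (tdom X j)" "B = tid X (tdom X x)" "D = tid X (tdom X y)"
  have ov: "j \<in> tights X" "x \<in> tights X" "y \<in> tights X" "tcod X j = E" "tcod X x = E" "tcod X y = E"
    using assms by (simp_all add: over_def)
  have t: "A \<in> tights X" "tdom X A = tdom X j" "tcod X A = tdom X j"
    "B \<in> tights X" "tdom X B = tdom X x" "tcod X B = tdom X x"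
    "D \<in> tights X" "tdom X D = tdom X y" "tcod X D = tdom X y"
    using tid_in[OF tdom_in[OF ov(1)]] tid_in[OF tdom_in[OF ov(2)]] tid_in[OF tdom_in[OF ov(3)]]
    unfolding ABD by simp_all
  have tc: "tcomp X j A = j" "tcomp X x B = x" "tcomp X y D = y" "tcomp X one x = x"
    "tcomp X one y = y" "tcomp X A A = A" "tcomp X B B = B" "tcomp X D D = D"
    using ov t tcomp_tid(1)[OF t(1)] tcomp_tid(1)[OF t(4)] tcomp_tid(1)[OF t(7)]
    by (simp_all add: ABD assms)
  \<comment> \<open>Composition \<open>E(j,1), E(1,x) \<Rightarrow> E(j,x)\<close>: precomposing
    with it trades \<open>E(j,x)\<close> for a pair beginning with \<open>E(j,1)\<close>, to which
    \<open>dense_star\<close> applies.\<close>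
  define s where "s = smile X j one x"
  have s: "s \<in> cells X" "cdom X s = [hom X j one, hom X one x]" "ccod X s = hom X j x" "cleft X s = A"
    "cright X s = B" "ccomp X (h j x) A [s] = h j one \<star> h one x"
    using smile[OF assms(1) over_one assms(2)] assms
    by (simp_all add: s_def glob_hom ABD flat_def)
  have Ux: "U x \<in> K [] (tcomp X one x) (tcomp X x B)" and Uy: "U y \<in> K [] (tcomp X y D) (tcomp X one y)"
    and hjx: "h j x \<in> K [hom X j x] (tcomp X j A) (tcomp X one x)"
    using U_in hom_cell(1) assms by (simp_all add: tc)
  obtain cx where cx: "cx \<in> cells X" "cdom X cx = []" "ccod X cx = hom X one x" "cleft X cx = x"
      "cright X cx = B" "ccomp X (h one x) x [cx] = U x"
    using hom_cell_factor[OF over_one assms(2) _ _ _ _ Ux] ov t tid_E by auto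
  obtain cy where cy: "cy \<in> cells X" "cdom X cy = []" "ccod X cy = hom X y one" "cleft X cy = D"
      "cright X cy = y" "ccomp X (h y one) D [cy] = U y"
    using hom_cell_factor[OF assms(3) over_one _ _ _ _ Uy] ov t tid_E by auto
  obtain r where r: "r \<in> cells X" "cdom X r = [hom X j x]" "ccod X r = hom X j one" "cleft X r = A"
      "cright X r = x" "ccomp X (h j one) A [r] = h j x"
    using hom_cell_factor[OF assms(1) over_one _ _ _ _ hjx] ov t tid_E by auto
  define ids where "ids = map (cid X) ps"
  have ids: "row X B ids" "row_right X B ids = D" "map (ccod X) ids = ps" "concat (map (cdom X) ids) = ps"
    using cid_row[OF assms(5)] by (simp_all add: ids_def ABD)
  define R where "R = [cx] @ ids @ [cy]"
  have R: "row X x R" "row_right X x R = y" "map (ccod X) R = hom X one x # ps @ [hom X y one]"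
    "concat (map (cdom X) R) = ps"
    using cx cy ids t ov by (simp_all add: R_def row_append row_right_append)
  have ids_act: "ccomp X \<phi> B ids = \<phi>" if "\<phi> \<in> K ps x y" for \<phi>
    using cid_right[OF K_D(1)[OF that]] K_D(2,4)[OF that] by (simp add: ids_def ABD)
  have split: "ccomp X (h j x \<star> \<phi>) A ([s] @ ids) = h j one \<star> h one x \<star> \<phi>" if "\<phi> \<in> K ps x y" for \<phi>
    using ids s t ov that
    by (subst star_row[OF hom_cell(1)[OF assms(1,2)] that]) (simp_all add: row_append ids_act)
  \<comment> \<open>\<open>R\<close> carries \<open>cx\<close> and \<open>cy\<close> at its ends,
    which turn the outer factors into \<open>U x\<close> and \<open>U y\<close>; hence
    precomposition with \<open>R\<close> undoes the extension of the chain.\<close>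
  have unsplit: "ccomp X (h one x \<star> \<phi> \<star> h y one) x R = \<phi>" if phi: "\<phi> \<in> K ps x y" for \<phi>
  proof -
    have "h one x \<star> \<phi> \<in> K ([hom X one x] @ ps) one y"
      using star_in[OF hom_cell(1)[OF over_one assms(2)] phi] .
    from star_row[OF this hom_cell(1)[OF assms(3) over_one], of x "[cx] @ ids" "[cy]"]
    have "ccomp X (h one x \<star> \<phi> \<star> h y one) x R = ccomp X (h one x \<star> \<phi>) x ([cx] @ ids) \<star> U y"
      using R cx cy ids ov tid_E by (simp add: R_def)
    also have "ccomp X (h one x \<star> \<phi>) x ([cx] @ ids) = U x \<star> \<phi>"
      using cx ids ov tid_E phi
      by (subst star_row[OF hom_cell(1)[OF over_one assms(2)] phi]) (simp_all add: ids_act)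
    finally show ?thesis
      using U_star[OF phi] star_U[OF phi] by simp
  qed
  have ch: "chain X E (hom X one x # ps @ [hom X y one]) E"
    using assms(5) hom_cell[OF over_one assms(2)] hom_cell[OF assms(3) over_one] tid_E E
    by (auto simp: chain_append)
  note dense = dense_star[OF assms(1,4) ch]
  have "inj_on (\<lambda>\<phi>. h j x \<star> \<phi>) (K ps x y)"
  proof (rule inj_onI)
    fix \<phi> \<phi>' assume phi: "\<phi> \<in> K ps x y" "\<phi>' \<in> K ps x y" and eq: "h j x \<star> \<phi> = h j x \<star> \<phi>'"
    have in1: "h one x \<star> \<phi> \<star> h y one \<in> K (hom X one x # ps @ [hom X y one]) one one" if "\<phi> \<in> K ps x y" for \<phi>
      using star_in[OF star_in[OF hom_cell(1)[OF over_one assms(2)] that] hom_cell(1)[OF assms(3) over_one]]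
      by simp
    have re: "h j one \<star> (h one x \<star> \<phi> \<star> h y one) = h j one \<star> h one x \<star> \<phi> \<star> h y one"
      if "\<phi> \<in> K ps x y" for \<phi>
    proof -
      note a = hom_cell(1)[OF assms(1) over_one] and b = hom_cell(1)[OF over_one assms(2)]
        and c = hom_cell(1)[OF assms(3) over_one]
      show ?thesis
        using star_assoc[OF a star_in[OF b that] c] star_assoc[OF a b that] by simp
    qed
    \<comment> \<open>Precompose \<open>eq\<close> with \<open>s\<close> and identities, multiply by
      \<open>h y one\<close> on the right, and rebracket so that \<open>h j one\<close> stands in
      front.\<close>
    have "h j one \<star> (h one x \<star> \<phi> \<star> h y one) = h j one \<star> (h one x \<star> \<phi>' \<star> h y one)"
      using split[OF phi(1)] split[OF phi(2)] eq by (simp add: re phi)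
    then have "h one x \<star> \<phi> \<star> h y one = h one x \<star> \<phi>' \<star> h y one"
      using dense in1[OF phi(1)] in1[OF phi(2)] by (metis bij_betw_imp_inj_on inj_onD)
    then show "\<phi> = \<phi>'"
      using unsplit phi by metis
  qed
  moreover have surj: "\<exists>\<phi>\<in>K ps x y. \<psi> = h j x \<star> \<phi>" if psi: "\<psi> \<in> K (hom X j x # ps) j y" for \<psi>
  proof -
    note p = K_D[OF psi]
    \<comment> \<open>The domain of \<open>\<psi>'\<close> starts with
      \<open>E(j,1), E(1,x)\<close>. Multiplying by \<open>h y one\<close> makes the right boundary
      \<open>one\<close>, so density yields a \<open>\<phi>\<close> for the extended chain.\<close>
    define \<psi>' where "\<psi>' = ccomp X \<psi> A ([s] @ ids)"
    have rs: "row X A ([s] @ ids)" "map (ccod X) ([s] @ ids) = hom X j x # ps" "tcod X A = tdom X j"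
      using s ids t by (simp_all)
    have psi': "\<psi>' \<in> K (hom X j one # hom X one x # ps) j y"
      using ccomp_in_K[OF psi rs] s ids by (simp add: \<psi>'_def tc row_right_append)
    have "\<psi>' \<star> h y one \<in> K (hom X j one # hom X one x # ps @ [hom X y one]) j one"
      using star_in[OF psi' hom_cell(1)[OF assms(3) over_one]] by simp
    then obtain \<phi> where phi: "\<phi> \<in> K (hom X one x # ps @ [hom X y one]) one one"
      and eq: "h j one \<star> \<phi> = \<psi>' \<star> h y one"
      using dense unfolding bij_betw_def by (metis (no_types, lifting) imageE)
    \<comment> \<open>The pair \<open>r, cx\<close> is a section of \<open>s\<close>: flattened, the
      claim is \<open>h j x \<star> U x = h j x\<close>. Precomposition with this pair therefore
      recovers \<open>\<psi>\<close> from \<open>\<psi>'\<close>.\<close>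
    have sr: "ccomp X s A [r, cx] = cid X (hom X j x)"
    proof (rule flat_inject[OF assms(1,2)])
      have c: "composable X s A [r, cx]"
        using s r cx t by (simp add: composable_def)
      show "ccomp X s A [r, cx] \<in> glob X [hom X j x] (hom X j x)"
        using s r cx by (simp add: glob_hom[OF assms(1,2)] ccomp_frame[OF c] tc ABD[symmetric])
      show "cid X (hom X j x) \<in> glob X [hom X j x] (hom X j x)"
        by (rule flat_cid[OF assms(1,2)])
      note hx = K_D[OF hom_cell(1)[OF assms(1,2)]]
        K_D(1,2,4)[OF star_in[OF hom_cell(1)[OF assms(1) over_one] hom_cell(1)[OF over_one assms(2)]]]
      have "flat j x (ccomp X s A [r, cx]) = ccomp X (ccomp X (h j x) A [s]) A [r, cx]"
        unfolding flat_def using hx s r cx t c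
        by (subst ccomp_assoc1) (simp_all add: composable_def ccomp_frame tc ABD[symmetric])
      also have "\<dots> = ccomp X (h j one \<star> h one x) A ([r] @ [cx])"
        by (simp add: s)
      also have "\<dots> = h j x \<star> U x"
        using r cx t
        by (subst star_row[OF hom_cell(1)[OF assms(1) over_one] hom_cell(1)[OF over_one assms(2)]]) auto
      finally show "flat j x (ccomp X s A [r, cx]) = flat j x (cid X (hom X j x))"
        using star_U[OF hom_cell(1)[OF assms(1,2)]] by (simp add: flat_cid[OF assms(1,2)])
    qed
    have row2: "row X A ([r, cx] @ ids)" "map (ccod X) ([r, cx] @ ids) = hom X j one # hom X one x # ps"
      using r cx ids t by simp_all
    have "ccomp X \<psi>' A ([r, cx] @ ids) = ccomp X \<psi> A (cid X (hom X j x) # ids)"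
    proof -
      have "distribute X B ids ids = ids"
        using distribute_cid[OF ids(1,3)] by (simp add: ids_def)
      then have "distribute X A ([s] @ ids) ([r, cx] @ ids) = cid X (hom X j x) # ids"
        using s sr r cx by simp
      then show ?thesis
        using ccomp_assoc[of \<psi> A "[s] @ ids" A "[r, cx] @ ids"] rs row2 K_D[OF psi'] p
        by (simp add: \<psi>'_def composable_def tc t)
    qed
    also have "\<dots> = \<psi>"
      using cid_right[OF p(1)] p by (simp add: ids_def ABD)
    finally have psi_back: "ccomp X \<psi>' A ([r, cx] @ ids) = \<psi>" .
    \<comment> \<open>The required preimage is \<open>\<phi>\<close> precomposed with
      \<open>R\<close>. The 2-cell \<open>r\<close> turns \<open>h j one\<close> into
      \<open>h j x\<close>, and its right boundary \<open>x\<close> is where \<open>R\<close>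
      starts; regrouping the same row gives \<open>\<psi> \<star> U y\<close>.\<close>
    have "h j x \<star> ccomp X \<phi> x R = ccomp X (h j one \<star> \<phi>) A ([r] @ R)"
      using r R t
      by (subst star_row[OF hom_cell(1)[OF assms(1) over_one] phi]) simp_all
    also have "\<dots> = ccomp X (\<psi>' \<star> h y one) A (([r, cx] @ ids) @ [cy])"
      by (simp add: eq R_def)
    also have "\<dots> = \<psi> \<star> U y"
      using row2 r cx cy ids t ov
      by (subst star_row[OF psi' hom_cell(1)[OF assms(3) over_one]])
        (simp_all add: row_append psi_back[simplified])
    finally have "\<psi> = h j x \<star> ccomp X \<phi> x R"
      using star_U[OF psi] by simp
    moreover have "ccomp X \<phi> x R \<in> K ps x y"
      using ccomp_in_K[OF phi R(1,3)] R(2,4) tid_E ov by (simp add: tc)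
    ultimately show ?thesis
      by (rule bexI)
  qed
  moreover have into: "h j x \<star> \<phi> \<in> K (hom X j x # ps) j y" if "\<phi> \<in> K ps x y" for \<phi>
    using star_in[OF hom_cell(1)[OF assms(1,2)] that] by simp
  ultimately show ?thesis
    by (simp add: bij_betw_def image_def set_eq_iff) metis
qed

end

section \<open>Globular 2-cells between endo-loose-cells\<close>

locale endo_calculus = hom_calculus X E
  for X :: "('o, 't, 'l, 'c, 'm) vequip_scheme" and E :: 'o +
  fixes A :: 'o
  assumes A: "A \<in> objs X"
begin

definition par :: "'t \<Rightarrow> bool" where
  "par x \<longleftrightarrow> x \<in> tights X \<and> tdom X x = A \<and> tcod X x = E"

definition endo :: "'l \<Rightarrow> bool" where
  "endo p \<longleftrightarrow> p \<in> looses X \<and> lsrc X p = A \<and> ltgt X p = A"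

text \<open>A common setting for globular 2-cells between endo-loose-cells and for members of
  \<open>K\<close> with left boundary out of \<open>A\<close>: for both, the row in
  \<open>gcomp\<close> starts at \<open>tid X A\<close>.\<close>

definition based :: "'c \<Rightarrow> 'l list \<Rightarrow> bool" where
  "based d ps \<longleftrightarrow> d \<in> cells X \<and> cdom X d = ps \<and> tdom X (cleft X d) = A"

lemma par_over: "par x \<Longrightarrow> over x"
  by (simp add: par_def over_def)

lemma par_dom: "par x \<Longrightarrow> tdom X x = A"
  by (simp add: par_def)

lemma endo_hom: "par x \<Longrightarrow> par y \<Longrightarrow> endo (hom X x y)"
  by (simp add: endo_def par_over par_dom hom_cell)

lemma tid_A: "tid X A \<in> tights X" "tdom X (tid X A) = A" "tcod X (tid X A) = A"
    "tcomp X (tid X A) (tid X A) = tid X A"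
  using tid_in[OF A] by auto

lemma glob_D:
  assumes "c \<in> glob X ps p" "endo p"
  shows "c \<in> cells X" "cdom X c = ps" "ccod X c = p" "cleft X c = tid X A" "cright X c = tid X A"
  using assms by (auto simp: glob_def endo_def)

lemma glob_based: "c \<in> glob X ps p \<Longrightarrow> endo p \<Longrightarrow> based c ps"
  by (simp add: based_def glob_D tid_A)

lemma K_based: "d \<in> K ps x y \<Longrightarrow> par x \<Longrightarrow> based d ps"
  by (simp add: based_def par_dom K_D(1,2,4))

lemma gcomp_eq: "based d ps \<Longrightarrow> gcomp X d cs = ccomp X d (tid X A) cs"
  by (simp add: gcomp_def based_def)

lemma cid_glob: "endo p \<Longrightarrow> cid X p \<in> glob X [p] p"
  by (simp add: glob_def endo_def cid_in)

lemma gcomp_cid1: "based d [p] \<Longrightarrow> gcomp X d [cid X p] = d"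
  using cid_right by (fastforce simp: based_def gcomp_def)

lemma gcomp_cid2: "based d [p, q] \<Longrightarrow> gcomp X d [cid X p, cid X q] = d"
  using cid_right by (fastforce simp: based_def gcomp_def)

lemma gcomp_nil: "based d [] \<Longrightarrow> gcomp X d [] = d"
  using cid_right by (fastforce simp: based_def gcomp_def)

lemma cid_gcomp:
  assumes "c \<in> glob X ps p" "endo p"
  shows "gcomp X (cid X p) [c] = c"
proof -
  have "gcomp X (cid X p) [c] = ccomp X (cid X p) (tid X A) [c]"
    by (rule gcomp_eq[OF glob_based[OF cid_glob]]) (rule assms)+
  then show ?thesis
    by (simp add: cid_ccomp glob_D[OF assms])
qed

lemma gcomp_glob:
  assumes "c \<in> glob X ps p" "endo p" "row X (tid X A) cs" "row_right X (tid X A) cs = tid X A"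
    "map (ccod X) cs = ps"
  shows "gcomp X c cs \<in> glob X (concat (map (cdom X) cs)) p"
proof -
  have "composable X c (tid X A) cs"
    using glob_D[OF assms(1,2)] assms(3-5) tid_A by (simp add: composable_def)
  note f = ccomp_frame[OF this]
  show ?thesis
    unfolding gcomp_eq[OF glob_based[OF assms(1,2)]] using assms(2)
    by (simp add: glob_def endo_def f glob_D[OF assms(1,2)] assms(4) tid_A)
qed

lemma gcomp_glob1:
  assumes "c \<in> glob X [p] q" "a \<in> glob X ps p" "endo p" "endo q"
  shows "gcomp X c [a] \<in> glob X ps q"
  using gcomp_glob[OF assms(1,4), of "[a]"] glob_D[OF assms(2,3)] tid_A by simp

lemma gcomp_glob2:
  assumes "c \<in> glob X [p, q] r" "a \<in> glob X ps p" "b \<in> glob X qs q" "endo p" "endo q" "endo r"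
  shows "gcomp X c [a, b] \<in> glob X (ps @ qs) r"
  using gcomp_glob[OF assms(1,6), of "[a, b]"] glob_D[OF assms(2,4)] glob_D[OF assms(3,5)] tid_A by simp

lemma gcomp_K1:
  assumes "d \<in> K [p] x y" "a \<in> glob X ps p" "endo p" "par x" "par y"
  shows "gcomp X d [a] \<in> K ps x y"
  using ccomp_in_K[OF assms(1), of "tid X A" "[a]"] glob_D[OF assms(2,3)] assms(4,5) tid_A
    gcomp_eq[OF K_based[OF assms(1,4)]]
  by (simp add: par_def)

lemma gcomp_assoc1:
  assumes "based d [p]" "a \<in> glob X ps p" "endo p" "row X (tid X A) cs" "map (ccod X) cs = ps"
  shows "gcomp X (gcomp X d [a]) cs = gcomp X d [gcomp X a cs]"
proof -
  have l: "length cs = length ps"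
    using assms(5) by auto
  note a = glob_D[OF assms(2,3)]
  have d: "d \<in> cells X" "cdom X d = [p]" "tdom X (cleft X d) = A" "cleft X d \<in> tights X"
    using assms(1) cell_frame[of d] by (auto simp: based_def)
  have c: "composable X d (tid X A) [a]"
    using d a tid_A by (simp add: composable_def)
  have b: "based (ccomp X d (tid X A) [a]) ps"
    using d a by (simp add: based_def ccomp_frame[OF c])
  show ?thesis
    unfolding gcomp_eq[OF assms(1)] gcomp_eq[OF b] gcomp_eq[OF glob_based[OF assms(2,3)]]
    using l assms(4,5) d a tid_A
    by (subst ccomp_assoc1[OF c]) (simp_all add: composable_def ccomp_frame[OF c])
qed

lemma gcomp_assoc2:
  assumes "based d [p, q]" "a \<in> glob X ps p" "b \<in> glob X qs q" "endo p" "endo q"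
    "row X (tid X A) (cs @ ds)" "row_right X (tid X A) cs = tid X A"
    "map (ccod X) cs = ps" "map (ccod X) ds = qs"
  shows "gcomp X (gcomp X d [a, b]) (cs @ ds) = gcomp X d [gcomp X a cs, gcomp X b ds]"
proof -
  have l: "length cs = length ps" "length ds = length qs"
    using assms(8,9) by auto
  note a = glob_D[OF assms(2,4)] and b = glob_D[OF assms(3,5)]
  have d: "d \<in> cells X" "cdom X d = [p, q]" "tdom X (cleft X d) = A" "cleft X d \<in> tights X"
    using assms(1) cell_frame[of d] by (auto simp: based_def)
  have c: "composable X d (tid X A) [a, b]"
    using d a b tid_A by (simp add: composable_def)
  have bs: "based (ccomp X d (tid X A) [a, b]) (ps @ qs)"
    using d a b by (simp add: based_def ccomp_frame[OF c])
  show ?thesis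
    unfolding gcomp_eq[OF assms(1)] gcomp_eq[OF bs] gcomp_eq[OF glob_based[OF assms(2,4)]]
      gcomp_eq[OF glob_based[OF assms(3,5)]]
    using l assms(6-9) d a b tid_A
    by (subst ccomp_assoc2[OF c]) (simp_all add: composable_def ccomp_frame[OF c])
qed

lemma gcomp_star:
  assumes "d \<in> K ps x y" "e \<in> K qs y z" "par x" "par y" "row X (tid X A) (cs @ ds)"
    "row_right X (tid X A) cs = tid X A" "map (ccod X) cs = ps" "map (ccod X) ds = qs"
  shows "gcomp X (d \<star> e) (cs @ ds) = gcomp X d cs \<star> gcomp X e ds"
  using star_row[OF assms(1,2,5,7,8)] assms(3,6) gcomp_eq[OF K_based[OF assms(1,3)]]
    gcomp_eq[OF K_based[OF assms(2,4)]] gcomp_eq[OF K_based[OF star_in[OF assms(1,2)] assms(3)]]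
  by (simp add: tid_A par_dom)

text \<open>The nullary factor receives the empty row, which acts as the identity, so the
  precomposition passes to the other factor.\<close>

lemma gcomp_star_0:
  assumes "d \<in> K [p] x y" "e \<in> K [] y z" "a \<in> glob X ps p" "endo p" "par x" "par y"
  shows "gcomp X (d \<star> e) [a] = gcomp X d [a] \<star> e"
  using gcomp_star[OF assms(1,2,5,6), of "[a]" "[]"] glob_D[OF assms(3,4)] tid_A
    gcomp_nil[OF K_based[OF assms(2,6)]] by simp

lemma gcomp_0_star:
  assumes "d \<in> K [] x y" "e \<in> K [p] y z" "a \<in> glob X ps p" "endo p" "par x" "par y"
  shows "gcomp X (d \<star> e) [a] = d \<star> gcomp X e [a]"
  using gcomp_star[OF assms(1,2,5,6), of "[]" "[a]"] glob_D[OF assms(3,4)] tid_A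
    gcomp_nil[OF K_based[OF assms(1,5)]] by simp

lemma gcomp_star_1:
  assumes "d \<in> K [p] x y" "e \<in> K [q] y z" "a \<in> glob X ps p" "b \<in> glob X qs q" "endo p" "endo q"
    "par x" "par y"
  shows "gcomp X (d \<star> e) [a, b] = gcomp X d [a] \<star> gcomp X e [b]"
  using gcomp_star[OF assms(1,2,7,8), of "[a]" "[b]"] glob_D[OF assms(3,5)] glob_D[OF assms(4,6)] tid_A
  by simp

lemma flat_K: "par x \<Longrightarrow> par y \<Longrightarrow> c \<in> glob X ps (hom X x y) \<Longrightarrow> flat x y c \<in> K ps x y"
  by (simp add: flat_in par_over)

lemma h_K: "par x \<Longrightarrow> par y \<Longrightarrow> h x y \<in> K [hom X x y] x y"
  by (simp add: hom_cell par_over)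

lemma U_K: "par x \<Longrightarrow> U x \<in> K [] x x"
  by (simp add: U_in par_over)

lemma h_gcomp: "par x \<Longrightarrow> par y \<Longrightarrow> gcomp X (h x y) [c] = flat x y c"
  using gcomp_eq[OF K_based[OF h_K]] by (simp add: flat_def par_dom)

lemma flat_eq_iff:
  "par x \<Longrightarrow> par y \<Longrightarrow> c \<in> glob X ps (hom X x y) \<Longrightarrow> c' \<in> glob X ps (hom X x y) \<Longrightarrow>
    c = c' \<longleftrightarrow> flat x y c = flat x y c'"
  using flat_inject[of x y c ps c'] par_over by blast

lemma flat_gcomp1:
  assumes "par x" "par y" "c \<in> glob X [p] (hom X x y)" "a \<in> glob X ps p" "endo p"
  shows "flat x y (gcomp X c [a]) = gcomp X (flat x y c) [a]"
  using glob_D[OF assms(4,5)] assms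
  by (subst flat_gcomp[OF par_over[OF assms(1)] par_over[OF assms(2)] assms(3)])
    (simp_all add: par_dom tid_A)

lemma flat_gcomp2:
  assumes "par x" "par y" "c \<in> glob X [p, q] (hom X x y)" "a \<in> glob X ps p" "b \<in> glob X qs q"
    "endo p" "endo q"
  shows "flat x y (gcomp X c [a, b]) = gcomp X (flat x y c) [a, b]"
  using glob_D[OF assms(4,6)] glob_D[OF assms(5,7)] assms
  by (subst flat_gcomp[OF par_over[OF assms(1)] par_over[OF assms(2)] assms(3)])
    (simp_all add: par_dom tid_A)

text \<open>Flattening turns the composition 2-cell into \<open>\<star>\<close>. The formulas for
  \<open>tight2_comp\<close>, \<open>hom_post\<close> and \<open>hom_pre\<close> are the instances
  where one or both arguments are nullary.\<close>

lemma smile_glob: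
  assumes "par x" "par y" "par z" "a \<in> glob X ps (hom X x y)" "b \<in> glob X qs (hom X y z)"
  shows "gcomp X (smile X x y z) [a, b] \<in> glob X (ps @ qs) (hom X x z)"
    "flat x z (gcomp X (smile X x y z) [a, b]) = flat x y a \<star> flat y z b"
proof -
  note e = endo_hom[OF assms(1,2)] endo_hom[OF assms(2,3)] endo_hom[OF assms(1,3)]
  note s = smile[OF par_over[OF assms(1)] par_over[OF assms(2)] par_over[OF assms(3)]]
  show "gcomp X (smile X x y z) [a, b] \<in> glob X (ps @ qs) (hom X x z)"
    by (rule gcomp_glob2[OF s(1) assms(4,5) e])
  show "flat x z (gcomp X (smile X x y z) [a, b]) = flat x y a \<star> flat y z b"
    using flat_gcomp2[OF assms(1,3) s(1) assms(4,5) e(1,2)]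
      gcomp_star_1[OF h_K[OF assms(1,2)] h_K[OF assms(2,3)] assms(4,5) e(1,2) assms(1,2)]
    by (simp add: s(2) h_gcomp assms)
qed

lemma cap_glob: "par x \<Longrightarrow> cap X x \<in> glob X [] (hom X x x)" "par x \<Longrightarrow> flat x x (cap X x) = U x"
  using cap[of x] by (simp_all add: par_over)

lemma hom_cid_glob:
  assumes "par x" "par y"
  shows "cid X (hom X x y) \<in> glob X [hom X x y] (hom X x y)" "flat x y (cid X (hom X x y)) = h x y"
  using flat_cid[of x y] assms by (simp_all add: par_over)

lemma tight2_comp_glob:
  assumes "par x" "par y" "par z" "\<sigma> \<in> tight2 X x y" "\<tau> \<in> tight2 X y z"
  shows "tight2_comp X x y z \<tau> \<sigma> \<in> tight2 X x z"
    "flat x z (tight2_comp X x y z \<tau> \<sigma>) = flat x y \<sigma> \<star> flat y z \<tau>"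
  using smile_glob[OF assms(1-3), of \<sigma> "[]" \<tau> "[]"] assms by (simp_all add: tight2_comp_def tight2_def)

lemma hom_post_glob:
  assumes "par x" "par y" "par z" "\<tau> \<in> tight2 X y z"
  shows "hom_post X x y z \<tau> \<in> glob X [hom X x y] (hom X x z)"
    "flat x z (hom_post X x y z \<tau>) = h x y \<star> flat y z \<tau>"
  using smile_glob[OF assms(1-3) hom_cid_glob(1)[OF assms(1,2)], of \<tau> "[]"] assms
  by (simp_all add: hom_post_def tight2_def hom_cid_glob)

lemma hom_pre_glob:
  assumes "par x" "par y" "par z" "\<tau> \<in> tight2 X x y"
  shows "hom_pre X x y z \<tau> \<in> glob X [hom X y z] (hom X x z)"
    "flat x z (hom_pre X x y z \<tau>) = flat x y \<tau> \<star> h y z"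
  using smile_glob[OF assms(1-3) _ hom_cid_glob(1)[OF assms(2,3)], of \<tau> "[]"] assms
  by (simp_all add: hom_pre_def tight2_def hom_cid_glob)

end

section \<open>Functors and pullbacks of categories\<close>

lemma category_Idm: "is_category C \<Longrightarrow> x \<in> Ob C \<Longrightarrow> Idm C x \<in> Hom C x x"
  by (simp add: is_category_def)

lemma category_Cmp:
  "is_category C \<Longrightarrow> x \<in> Ob C \<Longrightarrow> y \<in> Ob C \<Longrightarrow> z \<in> Ob C \<Longrightarrow> f \<in> Hom C x y \<Longrightarrow> g \<in> Hom C y z \<Longrightarrow>
    Cmp C x y z g f \<in> Hom C x z"
  by (simp add: is_category_def)

lemma functor_category: "is_functor C D F \<Longrightarrow> is_category C \<and> is_category D"
  by (simp add: is_functor_def)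

lemma functor_ob: "is_functor C D F \<Longrightarrow> x \<in> Ob C \<Longrightarrow> fob F x \<in> Ob D"
  by (simp add: is_functor_def)

lemma functor_mor:
  "is_functor C D F \<Longrightarrow> x \<in> Ob C \<Longrightarrow> y \<in> Ob C \<Longrightarrow> f \<in> Hom C x y \<Longrightarrow>
    fmor F x y f \<in> Hom D (fob F x) (fob F y)"
  by (simp add: is_functor_def)

lemma functor_Idm: "is_functor C D F \<Longrightarrow> x \<in> Ob C \<Longrightarrow> fmor F x x (Idm C x) = Idm D (fob F x)"
  by (simp add: is_functor_def)

lemma functor_Cmp:
  "is_functor C D F \<Longrightarrow> x \<in> Ob C \<Longrightarrow> y \<in> Ob C \<Longrightarrow> z \<in> Ob C \<Longrightarrow> f \<in> Hom C x y \<Longrightarrow> g \<in> Hom C y z \<Longrightarrow>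
    fmor F x z (Cmp C x y z g f) = Cmp D (fob F x) (fob F y) (fob F z) (fmor F y z g) (fmor F x y f)"
  by (simp add: is_functor_def)

text \<open>An elementwise criterion: objects, and morphisms between fixed objects, correspond
  bijectively to matching pairs. The surjectivity parts construct the mediating functor; the
  injectivity parts give its functoriality and its uniqueness.\<close>

lemma is_pullbackI:
  fixes P :: "('a, 'b) cat" and B :: "('c, 'd) cat" and C :: "('e, 'f) cat" and D :: "('g, 'h) cat"
  assumes "is_functor P B F" "is_functor P C U" "is_functor B D V" "is_functor C D G"
    and "funct_eq P (funct_comp V F) (funct_comp G U)"
    and ob: "\<And>b c. b \<in> Ob B \<Longrightarrow> c \<in> Ob C \<Longrightarrow> fob V b = fob G c \<Longrightarrow> \<exists>p\<in>Ob P. fob F p = b \<and> fob U p = c"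
    and ob_inj: "\<And>p p'. p \<in> Ob P \<Longrightarrow> p' \<in> Ob P \<Longrightarrow> fob F p = fob F p' \<Longrightarrow> fob U p = fob U p' \<Longrightarrow> p = p'"
    and mor: "\<And>p p' f g. p \<in> Ob P \<Longrightarrow> p' \<in> Ob P \<Longrightarrow> f \<in> Hom B (fob F p) (fob F p') \<Longrightarrow>
      g \<in> Hom C (fob U p) (fob U p') \<Longrightarrow> fmor V (fob F p) (fob F p') f = fmor G (fob U p) (fob U p') g \<Longrightarrow>
      \<exists>k\<in>Hom P p p'. fmor F p p' k = f \<and> fmor U p p' k = g"
    and mor_inj: "\<And>p p' k k'. p \<in> Ob P \<Longrightarrow> p' \<in> Ob P \<Longrightarrow> k \<in> Hom P p p' \<Longrightarrow> k' \<in> Hom P p p' \<Longrightarrow>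
      fmor F p p' k = fmor F p p' k' \<Longrightarrow> fmor U p p' k = fmor U p p' k' \<Longrightarrow> k = k'"
  shows "is_pullback TYPE('zx) TYPE('zm) P B C D F U V G"
proof -
  note catP = functor_category[OF assms(1), THEN conjunct1]
  note F = functor_Idm[OF assms(1)] functor_Idm[OF assms(2)]
    and FC = functor_Cmp[OF assms(1)] functor_Cmp[OF assms(2)]
  have "\<exists>M. is_functor Z P M \<and> funct_eq Z (funct_comp F M) H \<and> funct_eq Z (funct_comp U M) L \<and>
      (\<forall>M'. is_functor Z P M' \<and> funct_eq Z (funct_comp F M') H \<and>
        funct_eq Z (funct_comp U M') L \<longrightarrow> funct_eq Z M M')"
    if H: "is_functor Z B H" and L: "is_functor Z C L"
      and comm: "funct_eq Z (funct_comp V H) (funct_comp G L)"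
    for Z :: "('zx, 'zm) cat" and H L
  proof -
    note catZ = functor_category[OF H, THEN conjunct1]
    \<comment> \<open>Choice is harmless here: \<open>ob_inj\<close> and \<open>mor_inj\<close>
      determine the chosen objects and morphisms.\<close>
    define mo where "mo z = (SOME p. p \<in> Ob P \<and> fob F p = fob H z \<and> fob U p = fob L z)" for z
    have mo: "mo z \<in> Ob P \<and> fob F (mo z) = fob H z \<and> fob U (mo z) = fob L z" if z: "z \<in> Ob Z" for z
    proof -
      have "fob V (fob H z) = fob G (fob L z)"
        using comm z by (simp add: funct_eq_def funct_comp_def)
      from ob[OF functor_ob[OF H z] functor_ob[OF L z] this]
      have "\<exists>p. p \<in> Ob P \<and> fob F p = fob H z \<and> fob U p = fob L z"
        by blast
      then show ?thesis
        unfolding mo_def by (rule someI_ex)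
    qed
    define mm where "mm y z f = (SOME k. k \<in> Hom P (mo y) (mo z) \<and>
      fmor F (mo y) (mo z) k = fmor H y z f \<and> fmor U (mo y) (mo z) k = fmor L y z f)" for y z f
    have mm: "mm y z f \<in> Hom P (mo y) (mo z) \<and> fmor F (mo y) (mo z) (mm y z f) = fmor H y z f \<and>
        fmor U (mo y) (mo z) (mm y z f) = fmor L y z f"
      if y: "y \<in> Ob Z" and z: "z \<in> Ob Z" and f: "f \<in> Hom Z y z" for y z f
    proof -
      have "fmor V (fob H y) (fob H z) (fmor H y z f) = fmor G (fob L y) (fob L z) (fmor L y z f)"
        using comm y z f by (simp add: funct_eq_def funct_comp_def)
      then have "\<exists>k. k \<in> Hom P (mo y) (mo z) \<and>
          fmor F (mo y) (mo z) k = fmor H y z f \<and> fmor U (mo y) (mo z) k = fmor L y z f"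
        using mor[of "mo y" "mo z" "fmor H y z f" "fmor L y z f"] mo[OF y] mo[OF z]
          functor_mor[OF H y z f] functor_mor[OF L y z f] by (simp add: Bex_def)
      then show ?thesis
        unfolding mm_def by (rule someI_ex)
    qed
    define M where "M = \<lparr>fob = mo, fmor = mm\<rparr>"
    \<comment> \<open>Preservation of identities, and below of composites, is tested after applying
      \<open>F\<close> and \<open>U\<close>, where it becomes functoriality of \<open>H\<close> and
      \<open>L\<close>.\<close>
    have idm: "mm x x (Idm Z x) = Idm P (mo x)" if x: "x \<in> Ob Z" for x
    proof (rule mor_inj[of "mo x" "mo x"])
      have i: "Idm Z x \<in> Hom Z x x"
        by (rule category_Idm[OF catZ x])
      note m = mm[OF x x i] mo[OF x]
      show "mo x \<in> Ob P" "mo x \<in> Ob P" "mm x x (Idm Z x) \<in> Hom P (mo x) (mo x)"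
        using m by simp_all
      show "Idm P (mo x) \<in> Hom P (mo x) (mo x)"
        using m category_Idm[OF catP] by simp
      show "fmor F (mo x) (mo x) (mm x x (Idm Z x)) = fmor F (mo x) (mo x) (Idm P (mo x))"
        "fmor U (mo x) (mo x) (mm x x (Idm Z x)) = fmor U (mo x) (mo x) (Idm P (mo x))"
        using m functor_Idm[OF H x] functor_Idm[OF L x] by (simp_all add: F)
    qed
    have cmp: "mm x z (Cmp Z x y z g f) = Cmp P (mo x) (mo y) (mo z) (mm y z g) (mm x y f)"
      if x: "x \<in> Ob Z" and y: "y \<in> Ob Z" and z: "z \<in> Ob Z" and f: "f \<in> Hom Z x y" and g: "g \<in> Hom Z y z"
      for x y z f g
    proof (rule mor_inj[of "mo x" "mo z"])
      have i: "Cmp Z x y z g f \<in> Hom Z x z"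
        by (rule category_Cmp[OF catZ that])
      note m = mm[OF x z i] mm[OF x y f] mm[OF y z g] mo[OF x] mo[OF y] mo[OF z]
      show "mo x \<in> Ob P" "mo z \<in> Ob P" "mm x z (Cmp Z x y z g f) \<in> Hom P (mo x) (mo z)"
        using m by simp_all
      show "Cmp P (mo x) (mo y) (mo z) (mm y z g) (mm x y f) \<in> Hom P (mo x) (mo z)"
        using m category_Cmp[OF catP] by simp
      show "fmor F (mo x) (mo z) (mm x z (Cmp Z x y z g f))
          = fmor F (mo x) (mo z) (Cmp P (mo x) (mo y) (mo z) (mm y z g) (mm x y f))"
        "fmor U (mo x) (mo z) (mm x z (Cmp Z x y z g f))
          = fmor U (mo x) (mo z) (Cmp P (mo x) (mo y) (mo z) (mm y z g) (mm x y f))"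
        using m functor_Cmp[OF H x y z f g] functor_Cmp[OF L x y z f g] by (simp_all add: FC)
    qed
    have "is_functor Z P M"
      using functor_category[OF H] functor_category[OF assms(1)] mo mm idm cmp
      by (simp add: is_functor_def M_def)
    moreover have "funct_eq Z (funct_comp F M) H" "funct_eq Z (funct_comp U M) L"
      using mo mm by (simp_all add: funct_eq_def funct_comp_def M_def)
    moreover have "funct_eq Z M M'" if M': "is_functor Z P M'" "funct_eq Z (funct_comp F M') H"
      "funct_eq Z (funct_comp U M') L" for M'
    proof -
      have eq: "fob F (fob M' z) = fob H z" "fob U (fob M' z) = fob L z" if "z \<in> Ob Z" for z
        using M'(2,3) that by (simp_all add: funct_eq_def funct_comp_def)
      \<comment> \<open>Objects come first, so that the morphisms of \<open>M'\<close> and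
        \<open>M\<close> lie in the same hom-set of \<open>P\<close> when \<open>mor_inj\<close> is
        applied.\<close>
      have fo: "fob M' z = mo z" if z: "z \<in> Ob Z" for z
        using mo[OF z] eq[OF z] functor_ob[OF M'(1) z] by (intro ob_inj) simp_all
      have fm: "fmor M' y z f = mm y z f" if y: "y \<in> Ob Z" and z: "z \<in> Ob Z" and f: "f \<in> Hom Z y z" for y z f
      proof -
        have "fmor F (fob M' y) (fob M' z) (fmor M' y z f) = fmor H y z f"
          "fmor U (fob M' y) (fob M' z) (fmor M' y z f) = fmor L y z f"
          using M'(2,3) y z f by (simp_all add: funct_eq_def funct_comp_def)
        then show ?thesis
          using mo[OF y] mo[OF z] mm[OF y z f] functor_mor[OF M'(1) y z f]
          by (intro mor_inj[of "mo y" "mo z"]) (simp_all add: fo y z)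
      qed
      show ?thesis
        using fo fm by (simp add: funct_eq_def M_def)
    qed
    ultimately show ?thesis
      by (intro exI[of _ M]) simp
  qed
  with assms(1-5) show ?thesis
    by (simp add: is_pullback_def)
qed

section \<open>Relative monads and loose-monads\<close>

locale relmonad_calculus = endo_calculus X E A
  for X :: "('o, 't, 'l, 'c, 'm) vequip_scheme" and E A :: 'o +
  fixes j :: 't
  assumes j: "par j"
begin

text \<open>The typing of a relative monad without its equations. The laws are translated at this
  level, so that a candidate can be built before its laws are verified.\<close>

definition data :: "('t, 'c) relmonad \<Rightarrow> bool" where
  "data T \<longleftrightarrow> par (carrier T) \<and> ext T \<in> glob X [hom X j (carrier T)] (hom X (carrier T) (carrier T)) \<and>
    eta T \<in> glob X [] (hom X j (carrier T))"

abbreviation hh where "hh T \<equiv> h j (carrier T)"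
abbreviation ee where "ee T \<equiv> flat (carrier T) (carrier T) (ext T)"
abbreviation ny where "ny T \<equiv> flat j (carrier T) (eta T)"
abbreviation mu where "mu T \<equiv> gcomp X (smile X j (carrier T) (carrier T)) [cid X (hom X j (carrier T)), ext T]"

lemma data_D:
  assumes "data T"
  shows "par (carrier T)" "ext T \<in> glob X [hom X j (carrier T)] (hom X (carrier T) (carrier T))"
    "eta T \<in> glob X [] (hom X j (carrier T))" "eta T \<in> tight2 X j (carrier T)"
    "endo (hom X j (carrier T))" "endo (hom X (carrier T) (carrier T))"
    "hh T \<in> K [hom X j (carrier T)] j (carrier T)"
    "ee T \<in> K [hom X j (carrier T)] (carrier T) (carrier T)"
    "ny T \<in> K [] j (carrier T)"
  using assms j by (simp_all add: data_def endo_hom h_K flat_K tight2_def)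

text \<open>Flattened, the left side is \<open>U j \<star> ny T\<close>. This simplifies the unit
  law of a relative monad and shows that the unit of \<open>assoc_loosemonad\<close> is
  \<open>eta\<close> itself.\<close>

lemma eta_unit:
  assumes "data T"
  shows "gcomp X (hom_post X j j (carrier T) (eta T)) [cap X j] = eta T"
proof -
  note T = data_D[OF assms] and p = hom_post_glob[OF j j data_D(1,4)[OF assms]]
  have "flat j (carrier T) (gcomp X (hom_post X j j (carrier T) (eta T)) [cap X j])
      = gcomp X (h j j \<star> ny T) [cap X j]"
    using flat_gcomp1[OF j T(1) p(1) cap_glob(1)[OF j] endo_hom[OF j j]] by (simp add: p(2))
  also have "\<dots> = U j \<star> ny T"
    using gcomp_star_0[OF h_K[OF j j] T(9) cap_glob(1)[OF j] endo_hom[OF j j] j j]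
    by (simp add: h_gcomp j cap_glob)
  also have "\<dots> = ny T"
    by (rule U_star[OF T(9)])
  finally show ?thesis
    using gcomp_glob1[OF p(1) cap_glob(1)[OF j] endo_hom[OF j j] T(5)]
    by (simp add: flat_eq_iff[OF j T(1) _ T(3)])
qed

lemma mult_glob:
  assumes "data T"
  shows "mu T \<in> glob X [hom X j (carrier T), hom X j (carrier T)] (hom X j (carrier T))"
    "flat j (carrier T) (mu T) = hh T \<star> ee T"
  using smile_glob[OF j data_D(1,1)[OF assms] hom_cid_glob(1)[OF j data_D(1)[OF assms]] data_D(2)[OF assms]]
  by (simp_all add: hom_cid_glob(2)[OF j data_D(1)[OF assms]])

text \<open>Each law equates globular 2-cells into \<open>E(j,t)\<close> or \<open>E(t,t)\<close>,
  and so is equivalent to its flattened form.\<close>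

lemma is_relmonad_iff:
  "is_relmonad X j T \<longleftrightarrow> data T \<and> ny T \<star> ee T = hh T \<and>
    gcomp X (ee T) [eta T] = U (carrier T) \<and> ee T \<star> ee T = gcomp X (ee T) [mu T]"
proof -
  let ?t = "carrier T"
  have d: "?t \<in> tights X \<and> tdom X ?t = tdom X j \<and> tcod X ?t = tcod X j \<and>
      ext T \<in> glob X [hom X j ?t] (hom X ?t ?t) \<and> eta T \<in> tight2 X j ?t \<longleftrightarrow> data T"
    using j by (auto simp: data_def par_def tight2_def)
  have iffs: "gcomp X (hom_pre X j ?t ?t (eta T)) [ext T] = cid X (hom X j ?t) \<longleftrightarrow> ny T \<star> ee T = hh T"
    "gcomp X (ext T) [eta T] = cap X ?t \<longleftrightarrow> gcomp X (ee T) [eta T] = U ?t"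
    "gcomp X (smile X ?t ?t ?t) [ext T, ext T] = gcomp X (ext T) [mu T]
      \<longleftrightarrow> ee T \<star> ee T = gcomp X (ee T) [mu T]" if "data T"
  proof -
    note T = data_D[OF that]
    note pre = hom_pre_glob[OF j T(1,1,4)]
    note mu = mult_glob[OF that]
    have "flat j ?t (gcomp X (hom_pre X j ?t ?t (eta T)) [ext T]) = ny T \<star> ee T"
      using flat_gcomp1[OF j T(1) pre(1) T(2,6)] gcomp_0_star[OF T(9) h_K[OF T(1,1)] T(2,6) j T(1)]
      by (simp add: pre(2) h_gcomp T(1))
    then show "gcomp X (hom_pre X j ?t ?t (eta T)) [ext T] = cid X (hom X j ?t) \<longleftrightarrow> ny T \<star> ee T = hh T"
      using flat_eq_iff[OF j T(1) gcomp_glob1[OF pre(1) T(2,6,5)] hom_cid_glob(1)[OF j T(1)]]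
      by (simp add: hom_cid_glob(2)[OF j T(1)])
    show "gcomp X (ext T) [eta T] = cap X ?t \<longleftrightarrow> gcomp X (ee T) [eta T] = U ?t"
      using flat_eq_iff[OF T(1,1) gcomp_glob1[OF T(2,3,5,6)] cap_glob(1)[OF T(1)]]
      by (simp add: cap_glob(2)[OF T(1)] flat_gcomp1[OF T(1,1,2,3,5)])
    note s = smile_glob[OF T(1,1,1,2,2)]
    show "gcomp X (smile X ?t ?t ?t) [ext T, ext T] = gcomp X (ext T) [mu T]
      \<longleftrightarrow> ee T \<star> ee T = gcomp X (ee T) [mu T]"
      using flat_eq_iff[OF T(1,1) s(1), simplified append.simps, OF gcomp_glob1[OF T(2) mu(1) T(5,6)]]
      by (simp add: s(2) flat_gcomp1[OF T(1,1,2) mu(1) T(5)])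
  qed
  have "is_relmonad X j T \<longleftrightarrow> data T \<and>
      gcomp X (hom_pre X j ?t ?t (eta T)) [ext T] = cid X (hom X j ?t) \<and>
      gcomp X (ext T) [gcomp X (hom_post X j j ?t (eta T)) [cap X j]] = cap X ?t \<and>
      gcomp X (smile X ?t ?t ?t) [ext T, ext T] = gcomp X (ext T) [mu T]"
    unfolding is_relmonad_def Let_def d[symmetric] by (simp only: conj_assoc)
  then show ?thesis
    by (cases "data T") (simp_all only: eta_unit iffs simp_thms)
qed

text \<open>Since \<open>mu T\<close> flattens to \<open>hh T \<star> ee T\<close>, filling its
  first slot with \<open>eta T\<close> gives the first relative monad law itself, while the right
  unit law and associativity become the other two laws multiplied by \<open>hh T\<close>.\<close>

lemma is_loosemonad_iff:
  assumes "data T"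
  shows "is_loosemonad X A (assoc_loosemonad X j T) \<longleftrightarrow> ny T \<star> ee T = hh T \<and>
    hh T \<star> gcomp X (ee T) [eta T] = hh T \<star> U (carrier T) \<and>
    hh T \<star> (ee T \<star> ee T) = hh T \<star> gcomp X (ee T) [mu T]"
proof -
  let ?t = "carrier T" and ?jt = "hom X j (carrier T)"
  note T = data_D[OF assms] and mu = mult_glob[OF assms]
  note c = hom_cid_glob[OF j T(1)]
  have ce: "gcomp X (ee T) [cid X ?jt] = ee T"
    by (rule gcomp_cid1[OF K_based[OF T(8,1)]])
  have "flat j ?t (gcomp X (mu T) [mu T, cid X ?jt]) = hh T \<star> (ee T \<star> ee T)"
    using flat_gcomp2[OF j T(1) mu(1) mu(1) c(1) T(5,5)] gcomp_star_1[OF T(7,8) mu(1) c(1) T(5,5) j T(1)]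
      star_assoc[OF T(7,8,8)]
    by (simp add: mu(2) h_gcomp j T(1) ce)
  moreover have "flat j ?t (gcomp X (mu T) [cid X ?jt, mu T]) = hh T \<star> gcomp X (ee T) [mu T]"
    using flat_gcomp2[OF j T(1) mu(1) c(1) mu(1) T(5,5)] gcomp_star_1[OF T(7,8) c(1) mu(1) T(5,5) j T(1)]
    by (simp add: mu(2) h_gcomp j T(1) c(2))
  moreover have "flat j ?t (gcomp X (mu T) [eta T, cid X ?jt]) = ny T \<star> ee T"
    using flat_gcomp2[OF j T(1) mu(1) T(3) c(1) T(5,5)] gcomp_star_1[OF T(7,8) T(3) c(1) T(5,5) j T(1)]
    by (simp add: mu(2) h_gcomp j T(1) ce)
  moreover have "flat j ?t (gcomp X (mu T) [cid X ?jt, eta T]) = hh T \<star> gcomp X (ee T) [eta T]"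
    using flat_gcomp2[OF j T(1) mu(1) c(1) T(3) T(5,5)] gcomp_star_1[OF T(7,8) c(1) T(3) T(5,5) j T(1)]
    by (simp add: mu(2) h_gcomp j T(1) c(2))
  \<comment> \<open>Writing \<open>hh T\<close> as \<open>hh T \<star> U ?t\<close> gives the right
    unit law a factor \<open>hh T\<close> on both sides, ready for cancellation.\<close>
  moreover have "hh T \<star> U ?t = hh T"
    by (rule star_U[OF T(7)])
  moreover note
    flat_eq_iff[OF j T(1) gcomp_glob2[OF mu(1) mu(1) c(1) T(5,5,5)], simplified append.simps,
      OF gcomp_glob2[OF mu(1) c(1) mu(1) T(5,5,5), simplified append.simps]]
    flat_eq_iff[OF j T(1) gcomp_glob2[OF mu(1) T(3) c(1) T(5,5,5), simplified append.simps] c(1)]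
    flat_eq_iff[OF j T(1) gcomp_glob2[OF mu(1) c(1) T(3) T(5,5,5), simplified append.simps] c(1)]
  ultimately have iffs:
    "gcomp X (mu T) [mu T, cid X ?jt] = gcomp X (mu T) [cid X ?jt, mu T] \<longleftrightarrow>
      hh T \<star> (ee T \<star> ee T) = hh T \<star> gcomp X (ee T) [mu T]"
    "gcomp X (mu T) [eta T, cid X ?jt] = cid X ?jt \<longleftrightarrow> ny T \<star> ee T = hh T"
    "gcomp X (mu T) [cid X ?jt, eta T] = cid X ?jt \<longleftrightarrow>
      hh T \<star> gcomp X (ee T) [eta T] = hh T \<star> U (carrier T)"
    by (simp_all only: c(2))
  show ?thesis
    using T(3,5) mu(1)
    by (simp add: is_loosemonad_def assoc_loosemonad_def Let_def eta_unit[OF assms] endo_def iffs conj_ac)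
qed

end

section \<open>The categories of loose-cells, loose-monads and tight-cells\<close>

context endo_calculus
begin

lemma gcomp_assoc11:
  assumes "c \<in> glob X [q] r" "b \<in> glob X [p] q" "a \<in> glob X ps p" "endo p" "endo q" "endo r"
  shows "gcomp X (gcomp X c [b]) [a] = gcomp X c [gcomp X b [a]]"
  using gcomp_assoc1[OF glob_based[OF assms(1,6)] assms(2,5), of "[a]"] glob_D[OF assms(3,4)] tid_A
  by simp

lemma gcomp_assoc12:
  assumes "c \<in> glob X [q] r" "b \<in> glob X [p, p'] q" "a \<in> glob X ps p" "a' \<in> glob X ps' p'"
    "endo p" "endo p'" "endo q" "endo r"
  shows "gcomp X (gcomp X c [b]) [a, a'] = gcomp X c [gcomp X b [a, a']]"
  using gcomp_assoc1[OF glob_based[OF assms(1,8)] assms(2,7), of "[a, a']"]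
    glob_D[OF assms(3,5)] glob_D[OF assms(4,6)] tid_A
  by simp

lemma gcomp_assoc21:
  assumes "c \<in> glob X [q, q'] r" "b \<in> glob X [p] q" "b' \<in> glob X [p'] q'"
    "a \<in> glob X ps p" "a' \<in> glob X ps' p'" "endo p" "endo p'" "endo q" "endo q'" "endo r"
  shows "gcomp X (gcomp X c [b, b']) [a, a'] = gcomp X c [gcomp X b [a], gcomp X b' [a']]"
  using gcomp_assoc2[OF glob_based[OF assms(1,10)] assms(2,3,8,9), of "[a]" "[a']"]
    glob_D[OF assms(4,6)] glob_D[OF assms(5,7)] tid_A
  by simp

lemma loose_cat_category: "is_category (loose_cat X A A)"
  unfolding is_category_def loose_cat_def
  using gcomp_assoc11 gcomp_glob1 cid_gcomp gcomp_cid1[OF glob_based] cid_glob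
  by (simp add: endo_def)

lemma loosemonad_D:
  assumes "is_loosemonad X A S"
  shows "endo (lcell S)" "mult S \<in> glob X [lcell S, lcell S] (lcell S)" "unit S \<in> glob X [] (lcell S)"
  using assms by (simp_all add: is_loosemonad_def Let_def endo_def)

lemma loosemonad_hom_cid:
  assumes "is_loosemonad X A S"
  shows "cid X (lcell S) \<in> loosemonad_hom X S S"
  using loosemonad_D[OF assms]
  by (simp add: loosemonad_hom_def cid_glob cid_gcomp gcomp_cid2[OF glob_based])

lemma loosemonad_hom_comp:
  assumes "is_loosemonad X A S" "is_loosemonad X A S'" "is_loosemonad X A S''"
    and "\<sigma> \<in> loosemonad_hom X S S'" "\<sigma>' \<in> loosemonad_hom X S' S''"
  shows "gcomp X \<sigma>' [\<sigma>] \<in> loosemonad_hom X S S''"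
proof -
  note S = loosemonad_D[OF assms(1)] and S' = loosemonad_D[OF assms(2)] and S'' = loosemonad_D[OF assms(3)]
  have s: "\<sigma> \<in> glob X [lcell S] (lcell S')" "gcomp X \<sigma> [unit S] = unit S'"
      "gcomp X \<sigma> [mult S] = gcomp X (mult S') [\<sigma>, \<sigma>]"
    and s': "\<sigma>' \<in> glob X [lcell S'] (lcell S'')" "gcomp X \<sigma>' [unit S'] = unit S''"
      "gcomp X \<sigma>' [mult S'] = gcomp X (mult S'') [\<sigma>', \<sigma>']"
    using assms(4,5) by (simp_all add: loosemonad_hom_def)
  have "gcomp X (gcomp X \<sigma>' [\<sigma>]) [mult S] = gcomp X \<sigma>' [gcomp X (mult S') [\<sigma>, \<sigma>]]"
    using gcomp_assoc11[OF s'(1) s(1) S(2,1) S'(1) S''(1)] by (simp add: s(3))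
  also have "\<dots> = gcomp X (gcomp X \<sigma>' [mult S']) [\<sigma>, \<sigma>]"
    using gcomp_assoc12[OF s'(1) S'(2) s(1,1) S'(1,1,1) S''(1)] by simp
  also have "\<dots> = gcomp X (mult S'') [gcomp X \<sigma>' [\<sigma>], gcomp X \<sigma>' [\<sigma>]]"
    using gcomp_assoc21[OF S''(2) s'(1,1) s(1,1) S'(1,1) S''(1,1,1)] by (simp add: s'(3))
  finally show ?thesis
    using gcomp_assoc11[OF s'(1) s(1) S(3,1) S'(1) S''(1)] gcomp_glob1[OF s'(1) s(1) S'(1) S''(1)]
    by (simp add: loosemonad_hom_def s s')
qed

lemma loosemonad_hom_glob: "\<sigma> \<in> loosemonad_hom X S S' \<Longrightarrow> \<sigma> \<in> glob X [lcell S] (lcell S')"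
  by (simp add: loosemonad_hom_def)

lemma LMnd_category: "is_category (LMnd X A)"
  unfolding is_category_def LMnd_def
  using loosemonad_hom_comp loosemonad_hom_cid
  by (simp add: gcomp_assoc11[OF loosemonad_hom_glob loosemonad_hom_glob loosemonad_hom_glob]
    cid_gcomp[OF loosemonad_hom_glob] gcomp_cid1[OF glob_based[OF loosemonad_hom_glob]] loosemonad_D(1))

lemma LMnd_forget_functor: "is_functor (LMnd X A) (loose_cat X A A) LMnd_forget"
  unfolding is_functor_def using LMnd_category loose_cat_category
  by (simp add: LMnd_def loose_cat_def LMnd_forget_def loosemonad_hom_glob
    loosemonad_D(1)[unfolded endo_def])

lemma tight_cat_Ob: "x \<in> Ob (tight_cat X A E) \<longleftrightarrow> par x"
  by (simp add: tight_cat_def par_def)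

lemma flat_tight2: "par x \<Longrightarrow> par y \<Longrightarrow> \<tau> \<in> tight2 X x y \<Longrightarrow> flat x y \<tau> \<in> K [] x y"
  by (simp add: tight2_def flat_K)

lemma tight2_eqI:
  "par x \<Longrightarrow> par y \<Longrightarrow> \<sigma> \<in> tight2 X x y \<Longrightarrow> \<tau> \<in> tight2 X x y \<Longrightarrow> flat x y \<sigma> = flat x y \<tau> \<Longrightarrow> \<sigma> = \<tau>"
  unfolding tight2_def by (simp add: flat_eq_iff)

lemma tight2_cap: "par x \<Longrightarrow> cap X x \<in> tight2 X x x"
  by (simp add: tight2_def cap_glob)

text \<open>Flattening sends \<open>tight2_comp\<close> to \<open>\<star>\<close> and
  \<open>cap\<close> to \<open>U\<close>, so the category laws for tight-cells are the laws of
  \<open>\<star>\<close>.\<close>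

lemma tight2_comp_cap:
  assumes "par x" "par y" "\<tau> \<in> tight2 X x y"
  shows "tight2_comp X x x y \<tau> (cap X x) = \<tau>" "tight2_comp X x y y (cap X y) \<tau> = \<tau>"
proof -
  note l = tight2_comp_glob[OF assms(1,1,2) tight2_cap[OF assms(1)] assms(3)]
    and r = tight2_comp_glob[OF assms(1,2,2,3) tight2_cap[OF assms(2)]]
  show "tight2_comp X x x y \<tau> (cap X x) = \<tau>"
    using U_star[OF flat_tight2[OF assms]]
    by (intro tight2_eqI[OF assms(1,2) l(1) assms(3)]) (simp add: l(2) cap_glob(2)[OF assms(1)])
  show "tight2_comp X x y y (cap X y) \<tau> = \<tau>"
    using star_U[OF flat_tight2[OF assms]]
    by (intro tight2_eqI[OF assms(1,2) r(1) assms(3)]) (simp add: r(2) cap_glob(2)[OF assms(2)])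
qed

lemma tight2_comp_assoc:
  assumes "par w" "par x" "par y" "par z" "\<rho> \<in> tight2 X w x" "\<sigma> \<in> tight2 X x y" "\<tau> \<in> tight2 X y z"
  shows "tight2_comp X w x z (tight2_comp X x y z \<tau> \<sigma>) \<rho> = tight2_comp X w y z \<tau> (tight2_comp X w x y \<sigma> \<rho>)"
proof -
  note rs = tight2_comp_glob[OF assms(1,2,3,5,6)] and st = tight2_comp_glob[OF assms(2,3,4,6,7)]
  note l = tight2_comp_glob[OF assms(1,2,4,5) st(1)] and r = tight2_comp_glob[OF assms(1,3,4) rs(1) assms(7)]
  show ?thesis
    using star_assoc[OF flat_tight2[OF assms(1,2,5)] flat_tight2[OF assms(2,3,6)] flat_tight2[OF assms(3,4,7)]]
    by (intro tight2_eqI[OF assms(1,4) l(1) r(1)]) (simp add: l(2) r(2) rs(2) st(2))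
qed

lemma tight_cat_category: "is_category (tight_cat X A E)"
  unfolding is_category_def Ball_def tight_cat_Ob
  by (simp add: tight_cat_def tight2_cap tight2_comp_glob(1) tight2_comp_cap tight2_comp_assoc)

end

section \<open>The functors of the square and the flattened laws for morphisms\<close>

context relmonad_calculus
begin

lemma hom_post_cap: "par x \<Longrightarrow> hom_post X j x x (cap X x) = cid X (hom X j x)"
  using hom_post_glob[OF j _ _ tight2_cap, of x] star_U[OF h_K[OF j, of x]]
  by (simp add: flat_eq_iff[OF j _ _ hom_cid_glob(1)[OF j]] cap_glob(2) hom_cid_glob(2)[OF j])

lemma hom_post_comp:
  assumes "par x" "par y" "par z" "\<sigma> \<in> tight2 X x y" "\<tau> \<in> tight2 X y z"
  shows "hom_post X j x z (tight2_comp X x y z \<tau> \<sigma>)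
    = gcomp X (hom_post X j y z \<tau>) [hom_post X j x y \<sigma>]"
proof -
  note st = tight2_comp_glob[OF assms]
  note p = hom_post_glob[OF j assms(1,3) st(1)] and s = hom_post_glob[OF j assms(1,2,4)]
    and t = hom_post_glob[OF j assms(2,3,5)]
  note e = endo_hom[OF j assms(1)] endo_hom[OF j assms(2)] endo_hom[OF j assms(3)]
  have "flat j z (gcomp X (hom_post X j y z \<tau>) [hom_post X j x y \<sigma>])
      = gcomp X (h j y \<star> flat y z \<tau>) [hom_post X j x y \<sigma>]"
    using flat_gcomp1[OF j assms(3) t(1) s(1) e(2)] by (simp add: t(2))
  also have "\<dots> = h j x \<star> flat x y \<sigma> \<star> flat y z \<tau>"
    using gcomp_star_0[OF h_K[OF j assms(2)] flat_tight2[OF assms(2,3,5)] s(1) e(2) j assms(2)]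
    by (simp add: h_gcomp[OF j assms(2)] s(2))
  also have "\<dots> = h j x \<star> (flat x y \<sigma> \<star> flat y z \<tau>)"
    by (rule star_assoc[OF h_K[OF j assms(1)] flat_tight2[OF assms(1,2,4)] flat_tight2[OF assms(2,3,5)]])
  finally show ?thesis
    using flat_eq_iff[OF j assms(3) p(1) gcomp_glob1[OF t(1) s(1) e(2,3)]] by (simp add: p(2) st(2))
qed

lemma hom_functor_functor: "is_functor (tight_cat X A E) (loose_cat X A A) (hom_functor X j)"
  unfolding is_functor_def Ball_def tight_cat_Ob using tight_cat_category loose_cat_category
  by (simp add: tight_cat_def loose_cat_def hom_functor_def hom_post_glob(1)[OF j] hom_post_cap hom_post_comp
    endo_hom[OF j, unfolded endo_def])

lemma relmonad_data: "is_relmonad X j T \<Longrightarrow> data T"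
  by (simp add: is_relmonad_iff)

abbreviation post where "post T T' \<equiv> hom_post X j (carrier T) (carrier T')"

lemma relmonad_hom_iff:
  assumes "data T" "data T'" "\<tau> \<in> tight2 X (carrier T) (carrier T')"
  defines "\<theta> \<equiv> flat (carrier T) (carrier T') \<tau>"
  shows "\<tau> \<in> relmonad_hom X j T T' \<longleftrightarrow> ny T \<star> \<theta> = ny T' \<and>
    ee T \<star> \<theta> = \<theta> \<star> gcomp X (ee T') [post T T' \<tau>]"
proof -
  let ?t = "carrier T" and ?t' = "carrier T'"
  note T = data_D[OF assms(1)] and T' = data_D[OF assms(2)] and th = flat_tight2[OF T(1) T'(1) assms(3)]
  note c = tight2_comp_glob[OF j T(1) T'(1) T(4) assms(3)]
  note p = hom_post_glob[OF j T(1) T'(1) assms(3)] and q = hom_post_glob[OF T(1,1) T'(1) assms(3)]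
    and r = hom_pre_glob[OF T(1) T'(1,1) assms(3)]
  note e = endo_hom[OF T(1) T'(1)]
  note ep = gcomp_glob1[OF T'(2) p(1) T'(5,6)]
  have "flat ?t ?t' (gcomp X (hom_post X ?t ?t ?t' \<tau>) [ext T]) = ee T \<star> \<theta>"
    using flat_gcomp1[OF T(1) T'(1) q(1) T(2,6)] gcomp_star_0[OF h_K[OF T(1,1)] th T(2,6,1,1)]
    by (simp add: q(2) h_gcomp[OF T(1,1)] \<theta>_def)
  moreover have "flat ?t ?t' (gcomp X (hom_pre X ?t ?t' ?t' \<tau>) [gcomp X (ext T') [post T T' \<tau>]])
      = \<theta> \<star> gcomp X (ee T') [post T T' \<tau>]"
    using flat_gcomp1[OF T(1) T'(1) r(1) ep T'(6)] gcomp_0_star[OF th h_K[OF T'(1,1)] ep T'(6) T(1) T'(1)]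
      flat_gcomp1[OF T'(1,1,2) p(1) T'(5)]
    by (simp add: r(2) h_gcomp[OF T'(1,1)] \<theta>_def)
  moreover note flat_eq_iff[OF T(1) T'(1) gcomp_glob1[OF q(1) T(2,6) e] gcomp_glob1[OF r(1) ep T'(6) e]]
    flat_eq_iff[OF j T'(1) c(1)[unfolded tight2_def] T'(3)]
  ultimately show ?thesis
    using assms(3) by (simp add: relmonad_hom_def Let_def c(2) \<theta>_def)
qed

text \<open>To be compared with \<open>relmonad_hom_iff\<close>: the unit conditions coincide, and
  the multiplication condition is the extension condition multiplied by \<open>hh T\<close>.\<close>

lemma loosemonad_hom_iff:
  assumes "data T" "data T'" "\<tau> \<in> tight2 X (carrier T) (carrier T')"
  defines "\<theta> \<equiv> flat (carrier T) (carrier T') \<tau>"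
  shows "post T T' \<tau> \<in> loosemonad_hom X (assoc_loosemonad X j T) (assoc_loosemonad X j T') \<longleftrightarrow>
    ny T \<star> \<theta> = ny T' \<and> hh T \<star> (ee T \<star> \<theta>) = hh T \<star> (\<theta> \<star> gcomp X (ee T') [post T T' \<tau>])"
proof -
  let ?t = "carrier T" and ?t' = "carrier T'"
  note T = data_D[OF assms(1)] and T' = data_D[OF assms(2)] and th = flat_tight2[OF T(1) T'(1) assms(3)]
  note p = hom_post_glob[OF j T(1) T'(1) assms(3)]
  note mu = mult_glob[OF assms(1)] and mu' = mult_glob[OF assms(2)]
  \<comment> \<open>As \<open>\<theta>\<close> is nullary, a 2-cell on top of
    \<open>hh T \<star> \<theta>\<close> meets only \<open>hh T\<close>; postcomposition with
    \<open>E(j,\<tau>)\<close> is thus multiplication by \<open>\<theta>\<close> on the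
    right.\<close>
  have act: "flat j ?t' (gcomp X (post T T' \<tau>) [c]) = flat j ?t c \<star> \<theta>"
    if "c \<in> glob X ps (hom X j ?t)" for c ps
    using flat_gcomp1[OF j T'(1) p(1) that T(5)] gcomp_star_0[OF T(7) th that T(5) j T(1)]
    by (simp add: p(2) h_gcomp[OF j T(1)] \<theta>_def)
  have "flat j ?t' (gcomp X (post T T' \<tau>) [mu T]) = hh T \<star> (ee T \<star> \<theta>)"
    using act[OF mu(1)] star_assoc[OF T(7,8) th] by (simp add: mu(2) \<theta>_def)
  moreover have "flat j ?t' (gcomp X (mu T') [post T T' \<tau>, post T T' \<tau>])
      = hh T \<star> (\<theta> \<star> gcomp X (ee T') [post T T' \<tau>])"
    using flat_gcomp2[OF j T'(1) mu'(1) p(1,1) T'(5,5)] gcomp_star_1[OF T'(7,8) p(1,1) T'(5,5) j T'(1)]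
      star_assoc[OF T(7) th gcomp_K1[OF T'(8) p(1) T'(5,1,1)]]
    by (simp add: mu'(2) h_gcomp[OF j T'(1)] p(2) \<theta>_def)
  moreover note flat_eq_iff[OF j T'(1) gcomp_glob1[OF p(1) mu(1) T(5) T'(5)]
      gcomp_glob2[OF mu'(1) p(1,1) T'(5,5,5), simplified append.simps]]
    flat_eq_iff[OF j T'(1) gcomp_glob1[OF p(1) T(3,5) T'(5)] T'(3)]
  ultimately show ?thesis
    using p(1) act[OF T(3)]
    by (simp add: loosemonad_hom_def assoc_loosemonad_def Let_def eta_unit[OF assms(1)] eta_unit[OF assms(2)])
qed

lemma relmonad_hom_tight2: "\<tau> \<in> relmonad_hom X j T T' \<Longrightarrow> \<tau> \<in> tight2 X (carrier T) (carrier T')"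
  by (simp add: relmonad_hom_def Let_def)

lemma relmonad_hom_cap:
  assumes "data T"
  shows "cap X (carrier T) \<in> relmonad_hom X j T T"
proof -
  note T = data_D[OF assms]
  have "gcomp X (ee T) [cid X (hom X j (carrier T))] = ee T"
    by (rule gcomp_cid1[OF K_based[OF T(8,1)]])
  then show ?thesis
    using star_U[OF T(9)] star_U[OF T(8)] U_star[OF T(8)]
    by (simp add: relmonad_hom_iff[OF assms assms tight2_cap[OF T(1)]] cap_glob(2)[OF T(1)] hom_post_cap[OF T(1)])
qed

lemma relmonad_hom_comp:
  assumes d: "data T" "data T'" "data T''"
    and t: "\<tau> \<in> relmonad_hom X j T T'" "\<tau>' \<in> relmonad_hom X j T' T''"
  shows "tight2_comp X (carrier T) (carrier T') (carrier T'') \<tau>' \<tau> \<in> relmonad_hom X j T T''"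
proof -
  note T = data_D[OF d(1)] and T' = data_D[OF d(2)] and T'' = data_D[OF d(3)]
  note tau = relmonad_hom_tight2[OF t(1)] and tau' = relmonad_hom_tight2[OF t(2)]
  note c = tight2_comp_glob[OF T(1) T'(1) T''(1) tau tau']
  let ?f = "flat (carrier T) (carrier T') \<tau>" and ?g = "flat (carrier T') (carrier T'') \<tau>'"
  note f = flat_tight2[OF T(1) T'(1) tau] and g = flat_tight2[OF T'(1) T''(1) tau']
  note p = hom_post_glob(1)[OF j T(1) T'(1) tau] and p' = hom_post_glob(1)[OF j T'(1) T''(1) tau']
  have r: "ny T \<star> ?f = ny T'" "ee T \<star> ?f = ?f \<star> gcomp X (ee T') [post T T' \<tau>]"
    using t(1) by (simp_all add: relmonad_hom_iff[OF d(1,2) tau])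
  have r': "ny T' \<star> ?g = ny T''" "ee T' \<star> ?g = ?g \<star> gcomp X (ee T'') [post T' T'' \<tau>']"
    using t(2) by (simp_all add: relmonad_hom_iff[OF d(2,3) tau'])
  note a' = gcomp_K1[OF T'(8) p T'(5,1,1)]
  note a'' = gcomp_K1[OF T''(8) p' T''(5,1,1)]
  note b'' = gcomp_K1[OF a'' p T'(5) T''(1,1)]
  have "ny T \<star> (?f \<star> ?g) = ny T''"
    using star_assoc[OF T(9) f g] by (simp add: r r')
  moreover have "ee T \<star> (?f \<star> ?g) = ?f \<star> ?g \<star> gcomp X (ee T'') [post T T'' (tight2_comp X (carrier T) (carrier T') (carrier T'') \<tau>' \<tau>)]"
  proof -
    have "ee T \<star> (?f \<star> ?g) = ?f \<star> (gcomp X (ee T') [post T T' \<tau>] \<star> ?g)"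
      using star_assoc[OF T(8) f g] star_assoc[OF f a' g] by (simp add: r(2))
    \<comment> \<open>The factor \<open>?g\<close> is nullary, so the precomposition can be moved
      outside the product, which exposes \<open>ee T' \<star> ?g\<close> to the law of
      \<open>\<tau>'\<close>.\<close>
    also have "gcomp X (ee T') [post T T' \<tau>] \<star> ?g = gcomp X (ee T' \<star> ?g) [post T T' \<tau>]"
      using gcomp_star_0[OF T'(8) g p T'(5,1,1)] by simp
    also have "\<dots> = ?g \<star> gcomp X (gcomp X (ee T'') [post T' T'' \<tau>']) [post T T' \<tau>]"
      using gcomp_0_star[OF g a'' p T'(5,1) T''(1)] by (simp add: r'(2))
    also have "gcomp X (gcomp X (ee T'') [post T' T'' \<tau>']) [post T T' \<tau>]
        = gcomp X (ee T'') [gcomp X (post T' T'' \<tau>') [post T T' \<tau>]]"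
      using gcomp_assoc1[OF K_based[OF T''(8,1)] p' T''(5), of "[post T T' \<tau>]"] glob_D[OF p T'(5)] tid_A
      by simp
    also have "gcomp X (post T' T'' \<tau>') [post T T' \<tau>]
        = post T T'' (tight2_comp X (carrier T) (carrier T') (carrier T'') \<tau>' \<tau>)"
      using hom_post_comp[OF T(1) T'(1) T''(1) tau tau'] by simp
    finally show ?thesis
      using star_assoc[OF f g gcomp_K1[OF T''(8) hom_post_glob(1)[OF j T(1) T''(1) c(1)] T''(5,1,1)]] by simp
  qed
  ultimately show ?thesis
    by (simp add: relmonad_hom_iff[OF d(1,3) c(1)] c(2))
qed

lemma RMnd_category: "is_category (RMnd X j)"
  unfolding is_category_def RMnd_def
  by (simp add: relmonad_hom_cap relmonad_hom_comp relmonad_data data_D(1) relmonad_hom_tight2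
    tight2_comp_cap tight2_comp_assoc)

lemma RMnd_forget_functor: "is_functor (RMnd X j) (tight_cat X A E) RMnd_forget"
  unfolding is_functor_def using RMnd_category tight_cat_category
  by (simp add: RMnd_def tight_cat_def RMnd_forget_def relmonad_hom_tight2
    data_D(1)[OF relmonad_data, unfolded par_def])

lemma assoc_loosemonad: "is_relmonad X j T \<Longrightarrow> is_loosemonad X A (assoc_loosemonad X j T)"
  by (simp add: is_loosemonad_iff relmonad_data) (simp add: is_relmonad_iff)

lemma relmonad_functor_functor: "is_functor (RMnd X j) (LMnd X A) (relmonad_functor X j)"
proof -
  have "post T T' \<tau> \<in> loosemonad_hom X (assoc_loosemonad X j T) (assoc_loosemonad X j T')"
    if "is_relmonad X j T" "is_relmonad X j T'" "\<tau> \<in> relmonad_hom X j T T'" for T T' \<tau>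
    using that(3) relmonad_hom_iff[OF relmonad_data[OF that(1)] relmonad_data[OF that(2)] relmonad_hom_tight2[OF that(3)]]
      loosemonad_hom_iff[OF relmonad_data[OF that(1)] relmonad_data[OF that(2)] relmonad_hom_tight2[OF that(3)]]
    by simp
  moreover have "lcell (assoc_loosemonad X j T) = hom X j (carrier T)" for T
    by (simp add: assoc_loosemonad_def Let_def)
  ultimately show ?thesis
    unfolding is_functor_def using RMnd_category LMnd_category
    by (simp add: RMnd_def LMnd_def relmonad_functor_def assoc_loosemonad hom_post_cap hom_post_comp
      data_D(1)[OF relmonad_data] relmonad_hom_tight2)
qed

section \<open>Consequences of density: full faithfulness and the pullback\<close>

lemma chain_endo: "endo p \<Longrightarrow> chain X A [p] A" "endo p \<Longrightarrow> chain X A [p, p] A" "chain X A [] A"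
  using A by (simp_all add: endo_def)

lemma dense_bij_flat:
  assumes "dense X j" "par x" "par y" "chain X A ps A"
  shows "bij_betw (\<lambda>\<phi>. h j x \<star> \<phi>) (K ps x y) (K (hom X j x # ps) j y)"
  using dense_bij[OF par_over[OF j] par_over[OF assms(2)] par_over[OF assms(3)] assms(1)] assms
  by (simp add: par_dom)

lemma dense_cancel:
  assumes "dense X j" "par x" "par y" "chain X A ps A" "\<phi> \<in> K ps x y" "\<psi> \<in> K ps x y"
  shows "h j x \<star> \<phi> = h j x \<star> \<psi> \<longleftrightarrow> \<phi> = \<psi>"
  using bij_betw_imp_inj_on[OF dense_bij_flat[OF assms(1-4)]] assms(5,6) by (auto dest: inj_onD)

text \<open>Followed by the bijection \<open>flat j y\<close>, this map is \<open>flat x y\<close>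
  followed by \<open>h j x \<star> _\<close>, which density makes bijective for the empty
  chain.\<close>

lemma hom_post_bij:
  assumes "dense X j" "par x" "par y"
  shows "bij_betw (hom_post X j x y) (tight2 X x y) (glob X [hom X j x] (hom X j y))"
proof -
  note f = flat_bij[OF par_over[OF assms(2)] par_over[OF assms(3)]]
    and fj = flat_bij[OF par_over[OF j] par_over[OF assms(3)]]
  have "bij_betw (\<lambda>\<tau>. h j x \<star> flat x y \<tau>) (tight2 X x y) (K [hom X j x] j y)"
    using bij_betw_trans[OF f dense_bij_flat[OF assms chain_endo(3)]] by (simp add: comp_def tight2_def)
  then have "bij_betw (flat j y \<circ> hom_post X j x y) (tight2 X x y) (K [hom X j x] j y)"
    by (rule bij_betw_cong[THEN iffD1, rotated]) (simp add: hom_post_glob(2)[OF j assms(2,3)])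
  moreover have "hom_post X j x y ` tight2 X x y \<subseteq> glob X [hom X j x] (hom X j y)"
    using hom_post_glob(1)[OF j assms(2,3)] by auto
  ultimately show ?thesis
    by (simp only: bij_betw_comp_iff2[OF fj])
qed

text \<open>Density cancels \<open>hh T\<close> from the multiplication condition, at the chain
  consisting of \<open>E(j,t)\<close> alone.\<close>

lemma relmonad_hom_reflect:
  assumes "dense X j" "data T" "data T'" "\<tau> \<in> tight2 X (carrier T) (carrier T')"
  shows "post T T' \<tau> \<in> loosemonad_hom X (assoc_loosemonad X j T) (assoc_loosemonad X j T') \<longleftrightarrow>
    \<tau> \<in> relmonad_hom X j T T'"
proof -
  note T = data_D[OF assms(2)] and T' = data_D[OF assms(3)]
  note th = flat_tight2[OF T(1) T'(1) assms(4)]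
  note p = hom_post_glob(1)[OF j T(1) T'(1) assms(4)]
  show ?thesis
    unfolding loosemonad_hom_iff[OF assms(2-4)] relmonad_hom_iff[OF assms(2-4)]
    using dense_cancel[OF assms(1) T(1) T'(1) chain_endo(1)[OF T(5)]]
      star_in[OF T(8) th] star_in[OF th gcomp_K1[OF T'(8) p T'(5,1,1)]] by simp
qed

text \<open>The bijection \<open>hom_post_bij\<close> restricts to the two sets of monad morphisms,
  which \<open>relmonad_hom_reflect\<close> matches with each other.\<close>

lemma relmonad_functor_ff:
  assumes "dense X j"
  shows "fully_faithful (RMnd X j) (LMnd X A) (relmonad_functor X j)"
proof -
  have "bij_betw (post T T') (relmonad_hom X j T T')
      (loosemonad_hom X (assoc_loosemonad X j T) (assoc_loosemonad X j T'))"
    if "is_relmonad X j T" "is_relmonad X j T'" for T T'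
  proof -
    note d = relmonad_data[OF that(1)] relmonad_data[OF that(2)]
    note b = hom_post_bij[OF assms data_D(1)[OF d(1)] data_D(1)[OF d(2)]]
    have sub: "relmonad_hom X j T T' \<subseteq> tight2 X (carrier T) (carrier T')"
      using relmonad_hom_tight2 by auto
    have lsub: "loosemonad_hom X (assoc_loosemonad X j T) (assoc_loosemonad X j T')
        \<subseteq> glob X [hom X j (carrier T)] (hom X j (carrier T'))"
      by (auto simp: loosemonad_hom_def assoc_loosemonad_def Let_def)
    have "post T T' ` relmonad_hom X j T T'
        = loosemonad_hom X (assoc_loosemonad X j T) (assoc_loosemonad X j T')"
    proof (intro subset_antisym subsetI)
      fix \<sigma> assume s: "\<sigma> \<in> loosemonad_hom X (assoc_loosemonad X j T) (assoc_loosemonad X j T')"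
      then obtain \<tau> where "\<tau> \<in> tight2 X (carrier T) (carrier T')" "\<sigma> = post T T' \<tau>"
        using lsub bij_betw_imp_surj_on[OF b] by (metis imageE subsetD)
      then show "\<sigma> \<in> post T T' ` relmonad_hom X j T T'"
        using s relmonad_hom_reflect[OF assms d] by simp
    next
      fix \<sigma> assume "\<sigma> \<in> post T T' ` relmonad_hom X j T T'"
      then show "\<sigma> \<in> loosemonad_hom X (assoc_loosemonad X j T) (assoc_loosemonad X j T')"
        using sub relmonad_hom_reflect[OF assms d] by auto
    qed
    then show ?thesis
      by (rule bij_betw_subset[OF b sub])
  qed
  then show ?thesis
    by (simp add: fully_faithful_def RMnd_def LMnd_def relmonad_functor_def)
qed

text \<open>The object part of the pullback. The unit of \<open>S\<close> serves as
  \<open>eta\<close>, and the extension is the unique \<open>\<phi>\<close> whose product with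
  \<open>h j t\<close> is the flattened multiplication of \<open>S\<close>.\<close>

lemma assoc_loosemonad_surj:
  assumes "dense X j" "is_loosemonad X A S" "par t" "lcell S = hom X j t"
  shows "\<exists>T. is_relmonad X j T \<and> assoc_loosemonad X j T = S \<and> carrier T = t"
proof -
  note S = loosemonad_D[OF assms(2), unfolded assms(4)]
  have "flat j t (mult S) \<in> K (hom X j t # [hom X j t]) j t"
    using flat_K[OF j assms(3) S(2)] by simp
  then have "flat j t (mult S) \<in> (\<lambda>\<phi>. h j t \<star> \<phi>) ` K [hom X j t] t t"
    by (simp only: bij_betw_imp_surj_on[OF dense_bij_flat[OF assms(1,3,3) chain_endo(1)[OF S(1)]]])
  then obtain \<phi> where phi: "\<phi> \<in> K [hom X j t] t t" "h j t \<star> \<phi> = flat j t (mult S)"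
    by (rule imageE) simp
  define T where "T = \<lparr>carrier = t, ext = hom_factor X t t \<phi>, eta = unit S\<rparr>"
  have d: "data T"
    using hom_factor(1)[OF phi(1)] S assms(3) by (simp add: data_def T_def)
  note T = data_D[OF d]
  have "mu T = mult S"
    using flat_eq_iff[OF j assms(3) _ S(2)] mult_glob[OF d] hom_factor(2)[OF phi(1)] phi(2)
    by (simp add: T_def)
  then have eq: "assoc_loosemonad X j T = S"
    using eta_unit[OF d] assms(4) by (simp add: assoc_loosemonad_def Let_def T_def)
  have "U (carrier T) \<in> K [] (carrier T) (carrier T)" "gcomp X (ee T) [eta T] \<in> K [] (carrier T) (carrier T)"
    "ee T \<star> ee T \<in> K [hom X j (carrier T), hom X j (carrier T)] (carrier T) (carrier T)"
    "gcomp X (ee T) [mu T] \<in> K [hom X j (carrier T), hom X j (carrier T)] (carrier T) (carrier T)"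
    using U_K[OF T(1)] gcomp_K1[OF T(8,3,5,1,1)] star_in[OF T(8,8)] gcomp_K1[OF T(8) mult_glob(1)[OF d] T(5,1,1)]
    by simp_all
  \<comment> \<open>Two cancellations of \<open>hh T\<close>: at the empty chain for the unit law,
    and at the chain of two copies of \<open>E(j,t)\<close> for associativity.\<close>
  then have "is_relmonad X j T"
    using assms(2) is_loosemonad_iff[OF d] d
      dense_cancel[OF assms(1) T(1,1) chain_endo(3)] dense_cancel[OF assms(1) T(1,1) chain_endo(2)[OF T(5)]]
    by (simp add: eq is_relmonad_iff)
  with eq show ?thesis
    by (auto simp: T_def)
qed

text \<open>The loose-monad has \<open>eta\<close> as its unit, and its multiplication determines
  \<open>hh T \<star> ee T\<close>, from which density recovers \<open>ext\<close>.\<close>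

lemma assoc_loosemonad_inject:
  assumes "dense X j" "data T" "data T'" "carrier T = carrier T'"
    "assoc_loosemonad X j T = assoc_loosemonad X j T'"
  shows "T = T'"
proof -
  note T = data_D[OF assms(2)] and T' = data_D[OF assms(3), folded assms(4)]
  have "eta T = eta T'" and mm: "mu T = mu T'"
    using assms(5) assms(4)
    by (simp_all add: assoc_loosemonad_def Let_def eta_unit[OF assms(2), unfolded assms(4)]
      eta_unit[OF assms(3)])
  moreover have "hh T \<star> ee T = hh T \<star> flat (carrier T) (carrier T) (ext T')"
    using mult_glob(2)[OF assms(2)] mult_glob(2)[OF assms(3)] mm by (simp add: assms(4))
  then have "ext T = ext T'"
    using dense_cancel[OF assms(1) T(1,1) chain_endo(1)[OF T(5)] T(8) T'(8)]
      flat_eq_iff[OF T(1,1,2) T'(2)] by simp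
  ultimately show ?thesis
    using assms(4) by simp
qed

lemma relmonad_pullback:
  assumes "dense X j"
  shows "is_pullback TYPE('zx) TYPE('zm)
         (RMnd X j) (LMnd X A) (tight_cat X A E) (loose_cat X A A)
         (relmonad_functor X j) RMnd_forget LMnd_forget (hom_functor X j)"
proof (rule is_pullbackI[OF relmonad_functor_functor RMnd_forget_functor LMnd_forget_functor hom_functor_functor])
  have l: "lcell (assoc_loosemonad X j T) = hom X j (carrier T)" for T
    by (simp add: assoc_loosemonad_def Let_def)
  show "funct_eq (RMnd X j) (funct_comp LMnd_forget (relmonad_functor X j))
      (funct_comp (hom_functor X j) RMnd_forget)"
    by (simp add: funct_eq_def funct_comp_def LMnd_forget_def relmonad_functor_def hom_functor_def
      RMnd_forget_def l)
  show "\<exists>T\<in>Ob (RMnd X j). fob (relmonad_functor X j) T = S \<and> fob RMnd_forget T = t"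
    if "S \<in> Ob (LMnd X A)" "t \<in> Ob (tight_cat X A E)" "fob LMnd_forget S = fob (hom_functor X j) t" for S t
    using assoc_loosemonad_surj[OF assms, of S t] that
    by (simp add: tight_cat_Ob) (auto simp: RMnd_def LMnd_def LMnd_forget_def relmonad_functor_def hom_functor_def RMnd_forget_def)
  show "T = T'" if "T \<in> Ob (RMnd X j)" "T' \<in> Ob (RMnd X j)"
    "fob (relmonad_functor X j) T = fob (relmonad_functor X j) T'" "fob RMnd_forget T = fob RMnd_forget T'" for T T'
    using assoc_loosemonad_inject[OF assms relmonad_data relmonad_data, of T T'] that
    by (simp add: RMnd_def relmonad_functor_def RMnd_forget_def)
  \<comment> \<open>The witness is \<open>\<rho>\<close> itself: commutativity says that
    \<open>\<sigma>\<close> is \<open>post T T' \<rho>\<close>, and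
    \<open>relmonad_hom_reflect\<close> makes \<open>\<rho>\<close> a morphism of relative
    monads.\<close>
  show "\<exists>\<tau>\<in>Hom (RMnd X j) T T'. fmor (relmonad_functor X j) T T' \<tau> = \<sigma> \<and> fmor RMnd_forget T T' \<tau> = \<rho>"
    if "T \<in> Ob (RMnd X j)" "T' \<in> Ob (RMnd X j)"
      "\<sigma> \<in> Hom (LMnd X A) (fob (relmonad_functor X j) T) (fob (relmonad_functor X j) T')"
      "\<rho> \<in> Hom (tight_cat X A E) (fob RMnd_forget T) (fob RMnd_forget T')"
      "fmor LMnd_forget (fob (relmonad_functor X j) T) (fob (relmonad_functor X j) T') \<sigma>
        = fmor (hom_functor X j) (fob RMnd_forget T) (fob RMnd_forget T') \<rho>"
    for T T' \<sigma> \<rho>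
    using relmonad_hom_reflect[OF assms relmonad_data relmonad_data, of T T' \<rho>] that
    by (simp add: RMnd_def LMnd_def tight_cat_def LMnd_forget_def relmonad_functor_def hom_functor_def
      RMnd_forget_def)
  show "\<tau> = \<tau>'" if "fmor RMnd_forget T T' \<tau> = fmor RMnd_forget T T' \<tau>'" for T T' and \<tau> \<tau>' :: 'c
    using that by (simp add: RMnd_forget_def)
qed

end

theorem theorem4p22:
  fixes X :: "('o, 't, 'l, 'c) vequip" and j :: 't and A E :: 'o
  assumes "virtual_equipment X"
    and "j \<in> tights X" and "tdom X j = A" and "tcod X j = E"
  shows "is_functor (RMnd X j) (LMnd X A) (relmonad_functor X j) \<and>
    (dense X j \<longrightarrow>
       fully_faithful (RMnd X j) (LMnd X A) (relmonad_functor X j) \<and>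
       is_pullback TYPE('zx) TYPE('zm)
         (RMnd X j) (LMnd X A) (tight_cat X A E) (loose_cat X A A)
         (relmonad_functor X j) RMnd_forget LMnd_forget (hom_functor X j))"
proof -
  interpret virtual_equipment X
    by fact
  interpret endo_calculus X E A
    using assms tdom_in[of j] tcod_in[of j] by unfold_locales auto
  interpret relmonad_calculus X E A j
    using assms by unfold_locales (simp add: par_def)
  show ?thesis
    using relmonad_functor_functor relmonad_functor_ff relmonad_pullback by (intro conjI impI)
qed

end
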